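(* Let $J\in\mathbb{C}^{n\times n}$ and let the Kronecker structure of the pencil $J-\mu J^H$ be $$K_J=\big(\mathcal{L}_{s_1}\oplus\dots\oplus\mathcal{L}_{s_a}\big)\oplus\big(\mathcal{Z}_{t_1}\oplus\dots\oplus\mathcal{Z}_{t_b}\big)\oplus\big(J_{m_1}^{\alpha_1}\oplus\dots\oplus J_{m_c}^{\alpha_c}\big)\oplus\bigoplus_{j=1}^d\mathcal{J}_{p_j}^{\lambda_j,*},$$ with $|\alpha_j|=1$ for all $j$ and $|\lambda_j|\neq0,1,\infty$ for all $j$. Write $\lambda_j\sim\lambda_k$ when $\{\lambda_j,1/\bar\lambda_j\}=\{\lambda_k,1/\bar\lambda_k\}$. Then the real dimension of the solution set $\{X\in\mathbb{C}^{n\times n}:X^HJ+JX=0\}$ is $D_L+D_Z+D_\alpha+D_P+D_I$, where \begin{align*} D_L&=\sum_{j=1}^a(2s_j+2)+\sum_{j<k}2\max(2s_j+1,2s_k+1)+2\cdot\#\{j<k:s_j=s_k\},\\ D_Z&=\sum_{j=1}^b2t_j+\sum_{j<k}\min(4t_j,4t_k),\\ D_\alpha&=\sum_{j=1}^cm_j+\sum_{j<k,\ \alpha_j=\alpha_k}\min(2m_j,2m_k),\\ D_P&=\sum_{j=1}^d2p_j+\sum_{j<k,\ \lambda_j\sim\lambda_k}\min(4p_j,4p_k),\\ D_I&=\sum_{j=1}^a\Big(2n-\sum_{k=1}^a(4s_k+2)\Big)=a\Big(2n-\sum_{k=1}^a(4s_k+2)\Big). \end{align*}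
   Context: $J^H$ is the conjugate transpose. The Kronecker structure of a pencil (with indeterminate $\mu$) is its Kronecker canonical form under strict equivalence $A-\mu B\mapsto P(A-\mu B)Q$ with $P,Q$ constant nonsingular complex matrices; the order of blocks is irrelevant. For finite $\lambda$, the symbol $J_r^\lambda$ in a Kronecker structure denotes the $r\times r$ Jordan block pencil with eigenvalue $\lambda$ (Jordan block minus $\mu I_r$), $J_r^\infty$ denotes the $r\times r$ block of the eigenvalue $\infty$ ($I_r-\mu N_r$, $N_r$ the nilpotent Jordan block), and $L_r$ is the $r\times(r+1)$ singular Kronecker block, with $L_r^T$ its transpose ($r\ge0$). The paired blocks are $\mathcal{L}_r=L_r\oplus L_r^T$ (size $(2r+1)\times(2r+1)$), $\mathcal{Z}_r=J_r^0\oplus J_r^\infty$ (size $2r\times2r$), $\mathcal{J}_r^{\lambda,*}=J_r^\lambda\oplus J_r^{1/\bar\lambda}$ (size $2r\times2r$). Every pencil $J-\mu J^H$ with $J\in\mathbb{C}^{n\times n}$ has a Kronecker structure of the form displayed in the claim (any of $a,b,c,d$ may be $0$). Sums over $j<k$ run over pairs of indices of the blocks concerned. The solution set is a real vector space. *)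

theory Defs
  imports
    Complex_Main
    "HOL-Library.Multiset"
    "Jordan_Normal_Form.Jordan_Normal_Form"
    "Jordan_Normal_Form.Schur_Decomposition"
    "Jordan_Normal_Form.VS_Connect"
begin

text \<open>The pair \<open>(A, B)\<close> of equally sized matrices stands for the pencil \<open>A - \<mu> B\<close>.\<close>

type_synonym pencil = "complex mat \<times> complex mat"

definition strictly_equivalent :: "pencil \<Rightarrow> pencil \<Rightarrow> bool" where
  "strictly_equivalent K K' \<longleftrightarrow>
     (\<exists>nr nc P Q. fst K \<in> carrier_mat nr nc \<and> snd K \<in> carrier_mat nr nc \<and>
        P \<in> carrier_mat nr nr \<and> invertible_mat P \<and>
        Q \<in> carrier_mat nc nc \<and> invertible_mat Q \<and>
        fst K' = P * fst K * Q \<and> snd K' = P * snd K * Q)"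

datatype kronecker_block =
    JordanFin nat complex
  | JordanInf nat
  | SingL nat
  | SingLT nat

definition singular_pencil :: "nat \<Rightarrow> pencil" where
  "singular_pencil r =
     (mat r (r + 1) (\<lambda>(i, j). if j = i + 1 then 1 else 0),
      mat r (r + 1) (\<lambda>(i, j). if j = i then 1 else 0))"

fun block_pencil :: "kronecker_block \<Rightarrow> pencil" where
  "block_pencil (JordanFin r z) = (jordan_block r z, 1\<^sub>m r)"
| "block_pencil (JordanInf r) = (1\<^sub>m r, jordan_block r 0)"
| "block_pencil (SingL r) = singular_pencil r"
| "block_pencil (SingLT r) =
     (transpose_mat (fst (singular_pencil r)), transpose_mat (snd (singular_pencil r)))"

text \<open>Jordan blocks have positive size, whereas \<open>L\<^sub>0\<close> (of size \<open>0 \<times> 1\<close>) and its transpose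
  are genuine blocks, contributing a zero column and a zero row, respectively.\<close>

fun proper_block :: "kronecker_block \<Rightarrow> bool" where
  "proper_block (JordanFin r z) \<longleftrightarrow> r \<ge> 1"
| "proper_block (JordanInf r) \<longleftrightarrow> r \<ge> 1"
| "proper_block (SingL r) \<longleftrightarrow> True"
| "proper_block (SingLT r) \<longleftrightarrow> True"

definition direct_sum_pencil :: "pencil list \<Rightarrow> pencil" where
  "direct_sum_pencil Ks = (diag_block_mat (map fst Ks), diag_block_mat (map snd Ks))"

text \<open>A Kronecker structure is a multiset of blocks, since their order is irrelevant; the list
  below is an arbitrary arrangement of it.\<close>

definition has_kronecker_structure :: "pencil \<Rightarrow> kronecker_block multiset \<Rightarrow> bool" where
  "has_kronecker_structure K M \<longleftrightarrow>
     (\<forall>b \<in># M. proper_block b) \<and>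
     (\<exists>bs. mset bs = M \<and> strictly_equivalent K (direct_sum_pencil (map block_pencil bs)))"

definition paired_L :: "nat \<Rightarrow> kronecker_block multiset" where
  "paired_L r = {#SingL r, SingLT r#}"

definition paired_Z :: "nat \<Rightarrow> kronecker_block multiset" where
  "paired_Z r = {#JordanFin r 0, JordanInf r#}"

definition paired_J :: "nat \<Rightarrow> complex \<Rightarrow> kronecker_block multiset" where
  "paired_J r z = {#JordanFin r z, JordanFin r (1 / cnj z)#}"

definition eigenvalue_sim :: "complex \<Rightarrow> complex \<Rightarrow> bool" where
  "eigenvalue_sim z z' \<longleftrightarrow> {z, 1 / cnj z} = {z', 1 / cnj z'}"

definition index_pairs :: "nat \<Rightarrow> (nat \<times> nat) set" where
  "index_pairs k = {(i, j). 1 \<le> i \<and> i < j \<and> j \<le> k}"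

text \<open>Complex matrices as a module over the reals. The fields \<open>mult\<close> and \<open>one\<close> of the record are
  not used by modules; they are filled in as in \<^const>\<open>module_mat\<close>.\<close>

definition real_module_mat :: "nat \<Rightarrow> nat \<Rightarrow> (real, complex mat) module" where
  "real_module_mat nr nc =
     \<lparr>carrier = carrier_mat nr nc, mult = (*), one = 1\<^sub>m nr, zero = 0\<^sub>m nr nc, add = (+),
      smult = (\<lambda>c X. complex_of_real c \<cdot>\<^sub>m X)\<rparr>"

definition solution_set :: "nat \<Rightarrow> complex mat \<Rightarrow> complex mat set" where
  "solution_set n J = {X \<in> carrier_mat n n. mat_adjoint X * J + J * X = 0\<^sub>m n n}"

definition solution_space :: "nat \<Rightarrow> complex mat \<Rightarrow> (real, complex mat) module" where
  "solution_space n J = (real_module_mat n n)\<lparr>carrier := solution_set n J\<rparr>"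

lemma mat_adjoint_index:
  "i < dim_col A \<Longrightarrow> j < dim_row A \<Longrightarrow> mat_adjoint A $$ (i, j) = conjugate (A $$ (j, i))"
  by (auto simp: mat_adjoint_def mat_of_rows_def)

lemma mat_adjoint_carrier:
  "A \<in> carrier_mat nr nc \<Longrightarrow> mat_adjoint A \<in> carrier_mat nc nr"
  by (auto simp: mat_adjoint_def mat_of_rows_def)

lemma vectorspace_real_module_mat: "vectorspace class_ring (real_module_mat nr nc)"
  unfolding vectorspace_def
proof (intro conjI)
  show "field (class_ring :: real ring)" by (rule class_field.field_axioms)
  have "abelian_group (real_module_mat nr nc)"
  proof (rule abelian_groupI)
    fix x assume "x \<in> carrier (real_module_mat nr nc)"
    then show "\<exists>y\<in>carrier (real_module_mat nr nc).
        y \<oplus>\<^bsub>real_module_mat nr nc\<^esub> x = \<zero>\<^bsub>real_module_mat nr nc\<^esub>"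
      by (intro bexI[of _ "- x"]) (auto simp: real_module_mat_def)
  qed (auto simp: real_module_mat_def comm_add_mat)
  then show "Module.module (class_ring :: real ring) (real_module_mat nr nc)"
    by (intro module.intro class_cring.cring_axioms module_axioms.intro)
      (auto simp: real_module_mat_def add_smult_distrib_left_mat add_smult_distrib_right_mat
        intro!: eq_matI simp: algebra_simps)
qed

lemma submodule_solution_set:
  assumes J: "J \<in> carrier_mat n n"
  shows "submodule class_ring (solution_set n J) (real_module_mat n n)"
proof -
  interpret V: vectorspace "class_ring :: real ring" "real_module_mat n n"
    by (rule vectorspace_real_module_mat)
  have zero: "mat_adjoint (0\<^sub>m n n :: complex mat) = 0\<^sub>m n n"
    using mat_adjoint_carrier[of "0\<^sub>m n n :: complex mat" n n]
    by (intro eq_matI) (auto simp: mat_adjoint_index)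
  have add: "mat_adjoint (X + Y) = mat_adjoint X + mat_adjoint Y"
    if "X \<in> carrier_mat n n" "Y \<in> carrier_mat n n" for X Y :: "complex mat"
    using that mat_adjoint_carrier[of X n n] mat_adjoint_carrier[of Y n n]
      mat_adjoint_carrier[of "X + Y" n n]
    by (intro eq_matI) (auto simp: mat_adjoint_index)
  have smult: "mat_adjoint (complex_of_real c \<cdot>\<^sub>m X) = complex_of_real c \<cdot>\<^sub>m mat_adjoint X"
    if "X \<in> carrier_mat n n" for X :: "complex mat" and c
    using that mat_adjoint_carrier[of X n n] mat_adjoint_carrier[of "complex_of_real c \<cdot>\<^sub>m X" n n]
    by (intro eq_matI) (auto simp: mat_adjoint_index)
  show ?thesis
  proof (intro submodule.intro V.module_axioms)
    show "solution_set n J \<subseteq> carrier (real_module_mat n n)"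
      by (auto simp: solution_set_def real_module_mat_def)
    show "\<zero>\<^bsub>real_module_mat n n\<^esub> \<in> solution_set n J"
      using J by (auto simp: solution_set_def real_module_mat_def zero)
  next
    fix X Y assume XY: "X \<in> solution_set n J" "Y \<in> solution_set n J"
    then have c: "X \<in> carrier_mat n n" "Y \<in> carrier_mat n n"
      and eq: "mat_adjoint X * J + J * X = 0\<^sub>m n n" "mat_adjoint Y * J + J * Y = 0\<^sub>m n n"
      by (auto simp: solution_set_def)
    note c' = c[THEN mat_adjoint_carrier]
    note carr = J c c' mult_carrier_mat[OF c'(1) J] mult_carrier_mat[OF c'(2) J]
      mult_carrier_mat[OF J c(1)] mult_carrier_mat[OF J c(2)]
    have "mat_adjoint (X + Y) * J + J * (X + Y)
        = (mat_adjoint X * J + mat_adjoint Y * J) + (J * X + J * Y)"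
      using carr by (simp add: add add_mult_distrib_mat[of _ n n] mult_add_distrib_mat[of _ n n])
    also have "\<dots> = (mat_adjoint X * J + J * X) + (mat_adjoint Y * J + J * Y)"
      using carr by (intro eq_matI) auto
    finally show "X \<oplus>\<^bsub>real_module_mat n n\<^esub> Y \<in> solution_set n J"
      using c eq by (simp add: solution_set_def real_module_mat_def)
  next
    fix c :: real and X assume "X \<in> solution_set n J"
    then have X: "X \<in> carrier_mat n n" and eq: "mat_adjoint X * J + J * X = 0\<^sub>m n n"
      by (auto simp: solution_set_def)
    note X' = mat_adjoint_carrier[OF X]
    have "mat_adjoint (complex_of_real c \<cdot>\<^sub>m X) * J + J * (complex_of_real c \<cdot>\<^sub>m X)
        = complex_of_real c \<cdot>\<^sub>m (mat_adjoint X * J) + complex_of_real c \<cdot>\<^sub>m (J * X)"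
      using J X X' by (simp add: smult mult_smult_distrib[of _ n n] mult_smult_assoc_mat[of _ n n])
    also have "\<dots> = complex_of_real c \<cdot>\<^sub>m (mat_adjoint X * J + J * X)"
      using mult_carrier_mat[OF X' J] mult_carrier_mat[OF J X]
      by (simp add: add_smult_distrib_left_mat[of _ n n])
    finally show "c \<odot>\<^bsub>real_module_mat n n\<^esub> X \<in> solution_set n J"
      using X eq by (simp add: solution_set_def real_module_mat_def)
  qed
qed

lemma vectorspace_solution_space:
  assumes "J \<in> carrier_mat n n"
  shows "vectorspace class_ring (solution_space n J)"
  unfolding solution_space_def
  using vectorspace.subspace_is_vs[OF vectorspace_real_module_mat]
    submodule_solution_set[OF assms] vectorspace_real_module_mat
  by (auto simp: subspace_def)

end

theory Submission
  imports Defs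
begin

text \<open>
  Multiplying out, \<open>X\<close> solves \<open>X\<^sup>H J + J X = 0\<close> if and only if the pair \<open>(-X\<^sup>H, X)\<close> is an endomorphism of the
  pencil \<open>(J, J\<^sup>H)\<close>, an endomorphism being a pair \<open>(Y, X)\<close> with \<open>Y J = J X\<close> and \<open>Y J\<^sup>H = J\<^sup>H X\<close>. For
  \<open>(-X\<^sup>H, X)\<close> the first condition is the equation for \<open>X\<close> and the second is the conjugate transpose of
  the first. The complex space of all endomorphisms carries the
  conjugate-linear involution \<open>(Y, X) \<mapsto> (-X\<^sup>H, -Y\<^sup>H)\<close>, whose fixed points are exactly the solutions. The
  solution set is therefore a real form of the endomorphism space, and its real dimension equals the
  complex dimension of that space (\<open>solution_space_dim\<close>).

  The dimension of the endomorphism space does not change under strict equivalence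
  (\<open>hom_dim_strictly_equivalent\<close>), and morphism spaces are additive under direct sums in both arguments
  (\<open>hom_dim_direct_sum_left\<close>, \<open>hom_dim_direct_sum_right\<close>). The dimension is thus the sum, over all ordered pairs
  of Kronecker blocks, of the dimension of the morphism space between the two blocks
  (\<open>kronecker_structure_hom_dim\<close>). The latter are determined by writing down the morphisms explicitly:
  they are Toeplitz or Hankel matrices, Krylov sequences, or zero (\<open>hom_dim_block\<close>).

  Summing this table over the paired blocks of the given structure produces the formula. Blocks of
  different kinds among the regular ones have disjoint spectra and contribute nothing, which gives
  \<open>D_Z\<close>, \<open>D_\<alpha>\<close> and \<open>D_P\<close> separately; the singular blocks among themselves give \<open>D_L\<close>; and each of the \<open>a\<close>
  singular pairs contributes the size of the regular part twice, once as source and once as target,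
  which is \<open>D_I\<close>.
\<close>

section \<open>Morphisms of pencils\<close>

definition pair_lincomb :: "complex \<Rightarrow> complex mat \<times> complex mat \<Rightarrow> complex mat \<times> complex mat
    \<Rightarrow> complex mat \<times> complex mat" where
  "pair_lincomb a u v = (a \<cdot>\<^sub>m fst u + fst v, a \<cdot>\<^sub>m snd u + snd v)"

text \<open>A chart identifies a complex space of matrix pairs with \<open>\<complex>\<^sup>d\<close>. Coordinate vectors are total functions of
  which only the first \<open>d\<close> values count, so that charts of different dimensions share one type and the
  coordinates of a direct sum are obtained by shifting the index.\<close>

definition linear_chart :: "((nat \<Rightarrow> complex) \<Rightarrow> complex mat \<times> complex mat) \<Rightarrow> nat
    \<Rightarrow> (complex mat \<times> complex mat) set \<Rightarrow> bool" where
  "linear_chart \<Psi> d H \<longleftrightarrow>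
     range \<Psi> = H \<and>
     (\<forall>g h. \<Psi> g = \<Psi> h \<longleftrightarrow> (\<forall>k<d. g k = h k)) \<and>
     (\<forall>a g h. \<Psi> (\<lambda>k. a * g k + h k) = pair_lincomb a (\<Psi> g) (\<Psi> h))"

lemma linear_chartD:
  assumes "linear_chart \<Psi> d H"
  shows "u \<in> H \<Longrightarrow> \<exists>h. \<Psi> h = u"
    and "\<Psi> h \<in> H"
    and "\<Psi> g = \<Psi> h \<longleftrightarrow> (\<forall>k<d. g k = h k)"
    and "\<Psi> (\<lambda>k. a * g k + h k) = pair_lincomb a (\<Psi> g) (\<Psi> h)"
proof -
  show "\<exists>h. \<Psi> h = u" if "u \<in> H"
    using assms that unfolding linear_chart_def by blast
qed (use assms in \<open>auto simp: linear_chart_def\<close>)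

text \<open>A pencil is a pair of parallel linear maps, that is, a representation of the Kronecker quiver. A
  morphism consists of a map \<open>Y\<close> between the targets and a map \<open>X\<close> between the sources that commute with
  both arrows.\<close>

definition pencil_hom :: "pencil \<Rightarrow> pencil \<Rightarrow> (complex mat \<times> complex mat) set" where
  "pencil_hom K K' =
     {(Y, X). Y \<in> carrier_mat (dim_row (fst K')) (dim_row (fst K)) \<and>
              X \<in> carrier_mat (dim_col (fst K')) (dim_col (fst K)) \<and>
              Y * fst K = fst K' * X \<and> Y * snd K = snd K' * X}"

definition hom_dim :: "pencil \<Rightarrow> pencil \<Rightarrow> nat \<Rightarrow> bool" where
  "hom_dim K K' d \<longleftrightarrow> (\<exists>\<Psi>. linear_chart \<Psi> d (pencil_hom K K'))"

definition pencil_carrier :: "nat \<Rightarrow> nat \<Rightarrow> pencil set" where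
  "pencil_carrier nr nc = carrier_mat nr nc \<times> carrier_mat nr nc"

lemma pencil_carrier_iff [simp]:
  "(A, B) \<in> pencil_carrier nr nc \<longleftrightarrow> A \<in> carrier_mat nr nc \<and> B \<in> carrier_mat nr nc"
  by (simp add: pencil_carrier_def)

lemma pencil_hom_iff:
  assumes "(A, B) \<in> pencil_carrier r c" "(A', B') \<in> pencil_carrier r' c'"
  shows "(Y, X) \<in> pencil_hom (A, B) (A', B') \<longleftrightarrow>
    Y \<in> carrier_mat r' r \<and> X \<in> carrier_mat c' c \<and> Y * A = A' * X \<and> Y * B = B' * X"
  using assms by (auto simp: pencil_hom_def)

lemma linear_chart_transport:
  assumes \<Psi>: "linear_chart \<Psi> d H"
    and bij: "bij_betw \<phi> H H'"
    and lin: "\<And>a u v. u \<in> H \<Longrightarrow> v \<in> H \<Longrightarrow> \<phi> (pair_lincomb a u v) = pair_lincomb a (\<phi> u) (\<phi> v)"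
  shows "linear_chart (\<phi> \<circ> \<Psi>) d H'"
proof -
  have H: "range \<Psi> = H" "\<And>h. \<Psi> h \<in> H" using \<Psi> by (auto simp: linear_chart_def)
  have "range (\<phi> \<circ> \<Psi>) = H'"
    using bij H(1) by (metis bij_betw_imp_surj_on image_comp)
  moreover have "\<phi> (\<Psi> g) = \<phi> (\<Psi> h) \<longleftrightarrow> (\<forall>k<d. g k = h k)" for g h
    using inj_on_eq_iff[OF bij_betw_imp_inj_on[OF bij] H(2) H(2)] \<Psi> by (simp add: linear_chart_def)
  moreover have "\<phi> (\<Psi> (\<lambda>k. a * g k + h k)) = pair_lincomb a (\<phi> (\<Psi> g)) (\<phi> (\<Psi> h))" for a g h
    using lin[OF H(2) H(2)] \<Psi> by (simp add: linear_chart_def)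
  ultimately show ?thesis by (simp add: linear_chart_def)
qed

lemma hom_dim_transport:
  assumes "hom_dim K K' d"
    and "bij_betw \<phi> (pencil_hom K K') (pencil_hom L L')"
    and "\<And>a u v. u \<in> pencil_hom K K' \<Longrightarrow> v \<in> pencil_hom K K' \<Longrightarrow>
      \<phi> (pair_lincomb a u v) = pair_lincomb a (\<phi> u) (\<phi> v)"
  shows "hom_dim L L' d"
  using assms linear_chart_transport unfolding hom_dim_def by blast

definition transpose_pencil :: "pencil \<Rightarrow> pencil" where
  "transpose_pencil K = (transpose_mat (fst K), transpose_mat (snd K))"

lemma transpose_pencil_carrier [simp]:
  "transpose_pencil K \<in> pencil_carrier c r \<longleftrightarrow> K \<in> pencil_carrier r c"
  by (cases K) (simp add: transpose_pencil_def)

lemma transpose_pencil_transpose [simp]: "transpose_pencil (transpose_pencil K) = K"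
  by (simp add: transpose_pencil_def)

lemma transpose_pencil_hom:
  assumes "K \<in> pencil_carrier r c" "K' \<in> pencil_carrier r' c'"
    and "(Y, X) \<in> pencil_hom K K'"
  shows "(transpose_mat X, transpose_mat Y) \<in> pencil_hom (transpose_pencil K') (transpose_pencil K)"
proof -
  obtain A B A' B' where K: "K = (A, B)" "K' = (A', B')" by (cases K, cases K') auto
  note c = assms(1,2)[unfolded K, simplified]
  have h: "Y \<in> carrier_mat r' r" "X \<in> carrier_mat c' c" "Y * A = A' * X" "Y * B = B' * X"
    using assms(3) c by (auto simp: K pencil_hom_def)
  have "transpose_mat X * transpose_mat A' = transpose_mat A * transpose_mat Y"
    using h c transpose_mult[of Y r' r A c] transpose_mult[of A' r' c' X c] by simp
  moreover have "transpose_mat X * transpose_mat B' = transpose_mat B * transpose_mat Y"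
    using h c transpose_mult[of Y r' r B c] transpose_mult[of B' r' c' X c] by simp
  ultimately show ?thesis using h c by (auto simp: K pencil_hom_def transpose_pencil_def)
qed

lemma transpose_lin:
  "U \<in> carrier_mat r c \<Longrightarrow> V \<in> carrier_mat r c \<Longrightarrow>
    transpose_mat (a \<cdot>\<^sub>m U + V) = a \<cdot>\<^sub>m transpose_mat U + transpose_mat (V :: complex mat)"
  by (intro eq_matI) auto

text \<open>Transposing \<open>Y A = A' X\<close> gives \<open>X\<^sup>T A'\<^sup>T = A\<^sup>T Y\<^sup>T\<close>, so transposition reverses the direction of morphisms. This
  turns statements about the source of a morphism into statements about its target.\<close>

lemma hom_dim_transpose:
  assumes K: "K \<in> pencil_carrier r c" "K' \<in> pencil_carrier r' c'" and d: "hom_dim K K' d"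
  shows "hom_dim (transpose_pencil K') (transpose_pencil K) d"
proof -
  let ?\<phi> = "\<lambda>(Y, X). (transpose_mat X, transpose_mat Y)"
  have KT: "transpose_pencil K \<in> pencil_carrier c r" "transpose_pencil K' \<in> pencil_carrier c' r'"
    using K by simp_all
  show ?thesis
  proof (rule hom_dim_transport[OF d, where \<phi> = ?\<phi>])
    show "bij_betw ?\<phi> (pencil_hom K K') (pencil_hom (transpose_pencil K') (transpose_pencil K))"
      using transpose_pencil_hom[OF K] transpose_pencil_hom[OF KT(2,1)]
      by (intro bij_betw_byWitness[where f' = ?\<phi>]) auto
  next
    fix a u v assume "u \<in> pencil_hom K K'" "v \<in> pencil_hom K K'"
    then show "?\<phi> (pair_lincomb a u v) = pair_lincomb a (?\<phi> u) (?\<phi> v)"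
      by (auto simp: pair_lincomb_def pencil_hom_def transpose_lin)
  qed
qed

text \<open>If \<open>L = P K Q\<close>, then conjugating \<open>Y\<close> by \<open>P\<close> and \<open>X\<close> by \<open>Q\<close> carries endomorphisms of \<open>L\<close> to endomorphisms of \<open>K\<close>.\<close>

lemma hom_dim_strictly_equivalent:
  assumes eq: "strictly_equivalent K L" and d: "hom_dim L L d"
  shows "hom_dim K K d"
proof -
  obtain A B A' B' where K: "K = (A, B)" "L = (A', B')" by (cases K, cases L) auto
  obtain nr nc P Q where c: "A \<in> carrier_mat nr nc" "B \<in> carrier_mat nr nc"
    "P \<in> carrier_mat nr nr" "Q \<in> carrier_mat nc nc"
    and inv: "invertible_mat P" "invertible_mat Q"
    and eqs: "A' = P * A * Q" "B' = P * B * Q"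
    using eq by (auto simp: strictly_equivalent_def K)
  obtain P' where P': "P' \<in> carrier_mat nr nr" "P' * P = 1\<^sub>m nr" "P * P' = 1\<^sub>m nr"
    using inv(1) c(3) unfolding invertible_mat_def inverts_mat_def
    by (metis carrier_matD carrier_matI index_mult_mat(2,3) index_one_mat(2,3))
  obtain Q' where Q': "Q' \<in> carrier_mat nc nc" "Q' * Q = 1\<^sub>m nc" "Q * Q' = 1\<^sub>m nc"
    using inv(2) c(4) unfolding invertible_mat_def inverts_mat_def
    by (metis carrier_matD carrier_matI index_mult_mat(2,3) index_one_mat(2,3))
  have c': "A' \<in> carrier_mat nr nc" "B' \<in> carrier_mat nr nc" using c eqs by auto
  have homK: "(Y, X) \<in> pencil_hom K K \<longleftrightarrow> Y \<in> carrier_mat nr nr \<and> X \<in> carrier_mat nc nc \<and>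
      Y * A = A * X \<and> Y * B = B * X" for Y X
    using c by (auto simp: K pencil_hom_def)
  have homL: "(Y, X) \<in> pencil_hom L L \<longleftrightarrow> Y \<in> carrier_mat nr nr \<and> X \<in> carrier_mat nc nc \<and>
      Y * A' = A' * X \<and> Y * B' = B' * X" for Y X
    using c' by (auto simp: K pencil_hom_def)
  note assoc = assoc_mult_mat[of _ nr nr _ nr _ nr] assoc_mult_mat[of _ nr nr _ nr _ nc]
    assoc_mult_mat[of _ nr nr _ nc _ nc] assoc_mult_mat[of _ nr nc _ nc _ nc]
    assoc_mult_mat[of _ nc nc _ nc _ nc]
  have cancel: "P' * (P * Z) = Z" "P * (P' * Z) = Z" if "Z \<in> carrier_mat nr k" for Z k
    using that c P' assoc_mult_mat[of P' nr nr P nr Z k] assoc_mult_mat[of P nr nr P' nr Z k] by auto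
  have cancel': "Q' * (Q * Z) = Z" "Q * (Q' * Z) = Z" if "Z \<in> carrier_mat nc k" for Z k
    using that c Q' assoc_mult_mat[of Q' nc nc Q nc Z k] assoc_mult_mat[of Q nc nc Q' nc Z k] by auto
  have conj: "P * Y * P' * (P * M * Q) = (P * M * Q) * (Q' * X * Q)"
    if YX: "Y \<in> carrier_mat nr nr" "X \<in> carrier_mat nc nc" and M: "M \<in> carrier_mat nr nc"
      and e: "Y * M = M * X" for Y X M
  proof -
    have "Y * (M * Q) = M * (X * Q)" using YX M c e assoc_mult_mat[of Y nr nr M nc Q nc] assoc_mult_mat[of M nr nc X nc Q nc] by simp
    then show ?thesis
      using YX M c P'(1) Q'(1) by (simp add: assoc cancel[of _ nc] cancel'[of _ nc])
  qed
  have conj': "P' * Y * P * M = M * (Q * X * Q')"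
    if YX: "Y \<in> carrier_mat nr nr" "X \<in> carrier_mat nc nc" and M: "M \<in> carrier_mat nr nc"
      and e: "Y * (P * M * Q) = (P * M * Q) * X" for Y X M
  proof -
    have "P' * (Y * (P * M * Q)) * Q' = P' * (P * M * Q * X) * Q'" by (simp add: e)
    then have "P' * (Y * (P * (M * (Q * Q')))) = M * (Q * (X * Q'))"
      using YX M c P'(1) Q'(1) by (simp add: assoc cancel[of _ nc])
    then show ?thesis
      using YX M c P'(1) Q' by (simp add: assoc)
  qed
  let ?\<phi> = "\<lambda>(Y, X). (P' * Y * P, Q * X * Q')"
  let ?\<psi> = "\<lambda>(Y, X). (P * Y * P', Q' * X * Q)"
  have inverse: "P * (P' * Y * P) * P' = Y" "P' * (P * Y * P') * P = Y"
    if "Y \<in> carrier_mat nr nr" for Y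
    using that c P' by (simp_all add: assoc cancel[of _ nr])
  have inverse': "Q * (Q' * Y * Q) * Q' = Y" "Q' * (Q * Y * Q') * Q = Y"
    if "Y \<in> carrier_mat nc nc" for Y
    using that c Q' by (simp_all add: assoc cancel'[of _ nc])
  show ?thesis
  proof (rule hom_dim_transport[OF d, where \<phi> = ?\<phi>])
    show "bij_betw ?\<phi> (pencil_hom L L) (pencil_hom K K)"
    proof (rule bij_betw_byWitness[where f' = ?\<psi>])
      show "\<forall>u\<in>pencil_hom L L. ?\<psi> (?\<phi> u) = u"
        by (clarsimp simp: homL inverse inverse' simp del: assoc_mult_mat)
      show "\<forall>u\<in>pencil_hom K K. ?\<phi> (?\<psi> u) = u"
        by (clarsimp simp: homK inverse inverse' simp del: assoc_mult_mat)
      show "?\<phi> ` pencil_hom L L \<subseteq> pencil_hom K K"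
      proof clarify
        fix Y X assume "(Y, X) \<in> pencil_hom L L"
        then have YX: "Y \<in> carrier_mat nr nr" "X \<in> carrier_mat nc nc"
          "Y * (P * A * Q) = P * A * Q * X" "Y * (P * B * Q) = P * B * Q * X"
          by (simp_all add: homL eqs)
        show "(P' * Y * P, Q * X * Q') \<in> pencil_hom K K"
          unfolding homK using conj'[OF YX(1,2) c(1) YX(3)] conj'[OF YX(1,2) c(2) YX(4)] YX(1,2) c P' Q'
          by auto
      qed
      show "?\<psi> ` pencil_hom K K \<subseteq> pencil_hom L L"
      proof clarify
        fix Y X assume "(Y, X) \<in> pencil_hom K K"
        then have YX: "Y \<in> carrier_mat nr nr" "X \<in> carrier_mat nc nc" "Y * A = A * X" "Y * B = B * X"
          by (simp_all add: homK)
        show "(P * Y * P', Q' * X * Q) \<in> pencil_hom L L"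
          unfolding homL eqs using conj[OF YX(1,2) c(1) YX(3)] conj[OF YX(1,2) c(2) YX(4)] YX(1,2) c P' Q'
          by auto
      qed
    qed
  next
    fix a u v assume uv: "u \<in> pencil_hom L L" "v \<in> pencil_hom L L"
    have lin: "S * (a \<cdot>\<^sub>m U + V) * T = a \<cdot>\<^sub>m (S * U * T) + S * V * T"
      if "S \<in> carrier_mat k k" "T \<in> carrier_mat k k" "U \<in> carrier_mat k k" "V \<in> carrier_mat k k"
      for S T U V :: "complex mat" and k
    proof -
      have "S * (a \<cdot>\<^sub>m U + V) * T = (a \<cdot>\<^sub>m (S * U) + S * V) * T"
        using that mult_add_distrib_mat[of S k k "a \<cdot>\<^sub>m U" k V] mult_smult_distrib[of S k k U k a] by simp
      also have "\<dots> = a \<cdot>\<^sub>m (S * U * T) + S * V * T"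
        using that add_mult_distrib_mat[of "a \<cdot>\<^sub>m (S * U)" k k "S * V" T k]
          mult_smult_assoc_mat[of "S * U" k k T k a] by simp
      finally show ?thesis .
    qed
    show "?\<phi> (pair_lincomb a u v) = pair_lincomb a (?\<phi> u) (?\<phi> v)"
      using uv c(3,4) P'(1) Q'(1) lin[of P' nr P] lin[of Q nc Q'] by (cases u, cases v) (simp add: pair_lincomb_def homL del: assoc_mult_mat)
  qed
qed

lemma hom_dim_0I:
  assumes "(A, B) \<in> pencil_carrier r c" "(A', B') \<in> pencil_carrier r' c'"
    and "\<And>Y X. Y \<in> carrier_mat r' r \<Longrightarrow> X \<in> carrier_mat c' c \<Longrightarrow> Y * A = A' * X \<Longrightarrow>
       Y * B = B' * X \<Longrightarrow> Y = 0\<^sub>m r' r \<and> X = 0\<^sub>m c' c"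
  shows "hom_dim (A, B) (A', B') 0"
proof -
  have "pencil_hom (A, B) (A', B') = {(0\<^sub>m r' r, 0\<^sub>m c' c)}"
    using assms by (fastforce simp: pencil_hom_iff[OF assms(1,2)])
  then have "linear_chart (\<lambda>_. (0\<^sub>m r' r, 0\<^sub>m c' c)) 0 (pencil_hom (A, B) (A', B'))"
    by (auto simp: linear_chart_def pair_lincomb_def)
  then show ?thesis by (auto simp: hom_dim_def)
qed

section \<open>Direct sums in the source\<close>

definition hcat :: "complex mat \<Rightarrow> complex mat \<Rightarrow> complex mat" where
  "hcat U V = four_block_mat U V (0\<^sub>m 0 (dim_col U)) (0\<^sub>m 0 (dim_col V))"

definition dsum :: "complex mat \<Rightarrow> complex mat \<Rightarrow> complex mat" where
  "dsum A B = four_block_mat A (0\<^sub>m (dim_row A) (dim_col B)) (0\<^sub>m (dim_row B) (dim_col A)) B"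

lemma dsum_carrier [simp]:
  "A \<in> carrier_mat r1 c1 \<Longrightarrow> B \<in> carrier_mat r2 c2 \<Longrightarrow> dsum A B \<in> carrier_mat (r1 + r2) (c1 + c2)"
  by (auto simp: dsum_def)

lemma hcat_carrier [simp]:
  "U \<in> carrier_mat r c1 \<Longrightarrow> V \<in> carrier_mat r c2 \<Longrightarrow> hcat U V \<in> carrier_mat r (c1 + c2)"
  unfolding hcat_def using four_block_carrier_mat[of U r c1 "0\<^sub>m 0 (dim_col V)" 0 c2] by auto

lemma dim_hcat [simp]: "dim_row (hcat U V) = dim_row U" "dim_col (hcat U V) = dim_col U + dim_col V"
  by (auto simp: hcat_def)

lemma hcat_index [simp]:
  "i < dim_row U \<Longrightarrow> j < dim_col U + dim_col V \<Longrightarrow>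
    hcat U V $$ (i, j) = (if j < dim_col U then U $$ (i, j) else V $$ (i, j - dim_col U))"
  by (auto simp: hcat_def)

lemma hcat_mult_dsum:
  assumes "Y1 \<in> carrier_mat r r1" "Y2 \<in> carrier_mat r r2"
    and "A1 \<in> carrier_mat r1 c1" "A2 \<in> carrier_mat r2 c2"
  shows "hcat Y1 Y2 * dsum A1 A2 = hcat (Y1 * A1) (Y2 * A2)"
  unfolding hcat_def dsum_def using assms
  by (subst mult_four_block_mat[of _ r r1 _ r2 _ 0 _ _ c1 _ c2]) auto

lemma mult_hcat:
  assumes "A \<in> carrier_mat r c" "X1 \<in> carrier_mat c c1" "X2 \<in> carrier_mat c c2"
  shows "A * hcat X1 X2 = hcat (A * X1) (A * X2)"
proof (rule eq_matI)
  fix i j assume "i < dim_row (hcat (A * X1) (A * X2))" "j < dim_col (hcat (A * X1) (A * X2))"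
  then have ij: "i < r" "j < c1 + c2" using assms by (auto simp: hcat_def)
  have "col (hcat X1 X2) j = (if j < c1 then col X1 j else col X2 (j - c1))"
    using assms ij
    by (intro eq_vecI) auto
  then show "(A * hcat X1 X2) $$ (i, j) = hcat (A * X1) (A * X2) $$ (i, j)"
    using assms ij by auto
qed (use assms in auto)

lemma hcat_inject:
  assumes "U \<in> carrier_mat r c1" "V \<in> carrier_mat r c2" "U' \<in> carrier_mat r c1" "V' \<in> carrier_mat r c2"
  shows "hcat U V = hcat U' V' \<longleftrightarrow> U = U' \<and> V = V'"
proof
  assume e: "hcat U V = hcat U' V'"
  have "U $$ (i, j) = U' $$ (i, j)" if "i < r" "j < c1" for i j
    using arg_cong[OF e, of "\<lambda>M. M $$ (i, j)"] that assms by auto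
  moreover have "V $$ (i, j) = V' $$ (i, j)" if "i < r" "j < c2" for i j
    using arg_cong[OF e, of "\<lambda>M. M $$ (i, c1 + j)"] that assms by auto
  ultimately show "U = U' \<and> V = V'" using assms by (auto intro!: eq_matI)
qed auto

lemma hcat_surj:
  assumes "M \<in> carrier_mat r (c1 + c2)"
  obtains U V where "U \<in> carrier_mat r c1" "V \<in> carrier_mat r c2" "M = hcat U V"
proof -
  define U where "U = mat r c1 (\<lambda>(i, j). M $$ (i, j))"
  define V where "V = mat r c2 (\<lambda>(i, j). M $$ (i, c1 + j))"
  have UV: "U \<in> carrier_mat r c1" "V \<in> carrier_mat r c2" by (auto simp: U_def V_def)
  moreover have "M = hcat U V"
    using assms by (intro eq_matI) (auto simp: U_def V_def)
  ultimately show ?thesis by (rule that)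
qed

lemma hcat_lin:
  assumes "U \<in> carrier_mat r c1" "V \<in> carrier_mat r c2" "U' \<in> carrier_mat r c1" "V' \<in> carrier_mat r c2"
  shows "hcat (a \<cdot>\<^sub>m U + U') (a \<cdot>\<^sub>m V + V') = a \<cdot>\<^sub>m hcat U V + hcat U' V'"
  using assms by (intro eq_matI) auto

text \<open>A morphism out of a direct sum is a pair of morphisms: splitting \<open>Y\<close> and \<open>X\<close> into column blocks
  decouples the equations, because \<open>dsum\<close> acts on each column block separately.\<close>

lemma hom_dim_dsum_left:
  assumes c1: "A1 \<in> carrier_mat r1 c1" "B1 \<in> carrier_mat r1 c1"
    and c2: "A2 \<in> carrier_mat r2 c2" "B2 \<in> carrier_mat r2 c2"
    and c: "A \<in> carrier_mat r c" "B \<in> carrier_mat r c"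
    and d1: "hom_dim (A1, B1) (A, B) d1" and d2: "hom_dim (A2, B2) (A, B) d2"
  shows "hom_dim (dsum A1 A2, dsum B1 B2) (A, B) (d1 + d2)"
proof -
  obtain \<Psi>1 \<Psi>2 where \<Psi>1: "linear_chart \<Psi>1 d1 (pencil_hom (A1, B1) (A, B))"
    and \<Psi>2: "linear_chart \<Psi>2 d2 (pencil_hom (A2, B2) (A, B))"
    using d1 d2 by (auto simp: hom_dim_def)
  define \<Psi> where "\<Psi> h = (let (Y1, X1) = \<Psi>1 h; (Y2, X2) = \<Psi>2 (\<lambda>k. h (d1 + k))
     in (hcat Y1 Y2, hcat X1 X2))" for h
  define shift where "shift h = (\<lambda>k. h (d1 + k))" for h :: "nat \<Rightarrow> complex"
  have \<Psi>_alt: "\<Psi> h = (hcat (fst (\<Psi>1 h)) (fst (\<Psi>2 (shift h))), hcat (snd (\<Psi>1 h)) (snd (\<Psi>2 (shift h))))" for h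
    by (simp add: \<Psi>_def shift_def split_beta Let_def)
  have m1: "fst (\<Psi>1 h) \<in> carrier_mat r r1" "snd (\<Psi>1 h) \<in> carrier_mat c c1"
    "fst (\<Psi>1 h) * A1 = A * snd (\<Psi>1 h)" "fst (\<Psi>1 h) * B1 = B * snd (\<Psi>1 h)" for h
  proof -
    have "\<Psi>1 h \<in> pencil_hom (A1, B1) (A, B)" using \<Psi>1 by (auto simp: linear_chart_def)
    then show "fst (\<Psi>1 h) \<in> carrier_mat r r1" "snd (\<Psi>1 h) \<in> carrier_mat c c1"
      "fst (\<Psi>1 h) * A1 = A * snd (\<Psi>1 h)" "fst (\<Psi>1 h) * B1 = B * snd (\<Psi>1 h)"
      using c c1 by (auto simp: pencil_hom_def)
  qed
  have m2: "fst (\<Psi>2 h) \<in> carrier_mat r r2" "snd (\<Psi>2 h) \<in> carrier_mat c c2"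
    "fst (\<Psi>2 h) * A2 = A * snd (\<Psi>2 h)" "fst (\<Psi>2 h) * B2 = B * snd (\<Psi>2 h)" for h
  proof -
    have "\<Psi>2 h \<in> pencil_hom (A2, B2) (A, B)" using \<Psi>2 by (auto simp: linear_chart_def)
    then show "fst (\<Psi>2 h) \<in> carrier_mat r r2" "snd (\<Psi>2 h) \<in> carrier_mat c c2"
      "fst (\<Psi>2 h) * A2 = A * snd (\<Psi>2 h)" "fst (\<Psi>2 h) * B2 = B * snd (\<Psi>2 h)"
      using c c2 by (auto simp: pencil_hom_def)
  qed
  have iff: "(Y, X) \<in> pencil_hom (dsum A1 A2, dsum B1 B2) (A, B) \<longleftrightarrow>
      Y \<in> carrier_mat r (r1 + r2) \<and> X \<in> carrier_mat c (c1 + c2) \<and>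
      Y * dsum A1 A2 = A * X \<and> Y * dsum B1 B2 = B * X" for Y X
    using c c1 c2 by (intro pencil_hom_iff) auto
  have in_hom: "\<Psi> h \<in> pencil_hom (dsum A1 A2, dsum B1 B2) (A, B)" for h
    using m1[of h] m2[of "shift h"] c c1 c2 hcat_carrier[OF m1(1) m2(1)] hcat_carrier[OF m1(2) m2(2)]
    by (auto simp: \<Psi>_alt iff hcat_mult_dsum[of _ r r1 _ r2] mult_hcat[of _ r c _ c1 _ c2])
  have onto: "\<exists>h. u = \<Psi> h" if u: "u \<in> pencil_hom (dsum A1 A2, dsum B1 B2) (A, B)" for u
  proof -
    obtain Y X where u_eq: "u = (Y, X)" by force
    have YX: "Y \<in> carrier_mat r (r1 + r2)" "X \<in> carrier_mat c (c1 + c2)"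
      "Y * dsum A1 A2 = A * X" "Y * dsum B1 B2 = B * X" using u by (auto simp: u_eq iff)
    obtain Y1 Y2 where Y: "Y1 \<in> carrier_mat r r1" "Y2 \<in> carrier_mat r r2" "Y = hcat Y1 Y2"
      by (rule hcat_surj[OF YX(1)])
    obtain X1 X2 where X: "X1 \<in> carrier_mat c c1" "X2 \<in> carrier_mat c c2" "X = hcat X1 X2"
      by (rule hcat_surj[OF YX(2)])
    have "hcat (Y1 * A1) (Y2 * A2) = hcat (A * X1) (A * X2)"
      using YX(3) Y X c c1 c2 by (simp add: hcat_mult_dsum[of _ r r1 _ r2] mult_hcat[of _ r c _ c1 _ c2])
    then have eA: "Y1 * A1 = A * X1" "Y2 * A2 = A * X2"
      using Y X c c1 c2 hcat_inject[of "Y1 * A1" r c1 "Y2 * A2" c2 "A * X1" "A * X2"] by auto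
    have "hcat (Y1 * B1) (Y2 * B2) = hcat (B * X1) (B * X2)"
      using YX(4) Y X c c1 c2 by (simp add: hcat_mult_dsum[of _ r r1 _ r2] mult_hcat[of _ r c _ c1 _ c2])
    then have eB: "Y1 * B1 = B * X1" "Y2 * B2 = B * X2"
      using Y X c c1 c2 hcat_inject[of "Y1 * B1" r c1 "Y2 * B2" c2 "B * X1" "B * X2"] by auto
    have "(Y1, X1) \<in> range \<Psi>1" "(Y2, X2) \<in> range \<Psi>2"
      using \<Psi>1 \<Psi>2 Y X c c1 c2 eA eB by (auto simp: linear_chart_def pencil_hom_def)
    then obtain h1 h2 where h: "\<Psi>1 h1 = (Y1, X1)" "\<Psi>2 h2 = (Y2, X2)" by (metis rangeE)
    define h where "h = (\<lambda>k. if k < d1 then h1 k else h2 (k - d1))"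
    have "\<Psi>1 h = \<Psi>1 h1" using \<Psi>1 by (simp add: linear_chart_def h_def)
    moreover have "shift h = h2" by (auto simp: shift_def h_def)
    ultimately show ?thesis using h Y(3) X(3) by (intro exI[of _ h]) (simp add: \<Psi>_alt u_eq)
  qed
  have inj: "\<Psi> g = \<Psi> h \<longleftrightarrow> (\<forall>k<d1 + d2. g k = h k)" for g h
  proof -
    have "\<Psi> g = \<Psi> h \<longleftrightarrow> \<Psi>1 g = \<Psi>1 h \<and> \<Psi>2 (shift g) = \<Psi>2 (shift h)"
      using hcat_inject[OF m1(1) m2(1) m1(1) m2(1)] hcat_inject[OF m1(2) m2(2) m1(2) m2(2)]
      by (auto simp: \<Psi>_alt prod_eq_iff)
    also have "\<dots> \<longleftrightarrow> (\<forall>k<d1. g k = h k) \<and> (\<forall>k<d2. g (d1 + k) = h (d1 + k))"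
      using \<Psi>1 \<Psi>2 by (simp add: linear_chart_def shift_def)
    also have "\<dots> \<longleftrightarrow> (\<forall>k<d1 + d2. g k = h k)"
    proof safe
      fix k assume "\<forall>k<d1. g k = h k" "\<forall>k<d2. g (d1 + k) = h (d1 + k)" "k < d1 + d2"
      then show "g k = h k"
        by (cases "k < d1") (auto dest!: spec[of _ "k - d1"])
    qed auto
    finally show ?thesis .
  qed
  have lin: "\<Psi> (\<lambda>k. a * g k + h k) = pair_lincomb a (\<Psi> g) (\<Psi> h)" for a g h
  proof -
    have "\<Psi>1 (\<lambda>k. a * g k + h k) = pair_lincomb a (\<Psi>1 g) (\<Psi>1 h)"
      "\<Psi>2 (\<lambda>k. a * shift g k + shift h k) = pair_lincomb a (\<Psi>2 (shift g)) (\<Psi>2 (shift h))"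
      using \<Psi>1 \<Psi>2 by (auto simp: linear_chart_def)
    moreover have "shift (\<lambda>k. a * g k + h k) = (\<lambda>k. a * shift g k + shift h k)"
      by (simp add: shift_def)
    ultimately show ?thesis
      using hcat_lin[OF m1(1) m2(1) m1(1) m2(1)] hcat_lin[OF m1(2) m2(2) m1(2) m2(2)]
      by (simp add: \<Psi>_alt pair_lincomb_def)
  qed
  have "linear_chart \<Psi> (d1 + d2) (pencil_hom (dsum A1 A2, dsum B1 B2) (A, B))"
    unfolding linear_chart_def using in_hom onto inj lin by blast
  then show ?thesis by (auto simp: hom_dim_def)
qed

section \<open>Products with the Kronecker blocks\<close>

lemma mult_mat_entry:
  assumes "M \<in> carrier_mat p q" "N \<in> carrier_mat q s" "i < p" "j < s"
  shows "(M * N) $$ (i, j) = (\<Sum>k<q. M $$ (i, k) * N $$ (k, j))"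
  using assms by (auto simp: scalar_prod_def lessThan_atLeast0)

lemma singular_pencil_carrier [simp]:
  "fst (singular_pencil r) \<in> carrier_mat r (r + 1)" "snd (singular_pencil r) \<in> carrier_mat r (r + 1)"
  by (auto simp: singular_pencil_def)

lemma mult_singular_fst:
  assumes "M \<in> carrier_mat p r"
  shows "M * fst (singular_pencil r) = mat p (r + 1) (\<lambda>(i, j). if j = 0 then 0 else M $$ (i, j - 1))"
proof (rule eq_matI)
  fix i j assume "i < dim_row (mat p (r + 1) (\<lambda>(i, j). if j = 0 then 0 else M $$ (i, j - 1)))"
    "j < dim_col (mat p (r + 1) (\<lambda>(i, j). if j = 0 then 0 else M $$ (i, j - 1)))"
  then have ij: "i < p" "j < r + 1" by auto
  have "(M * fst (singular_pencil r)) $$ (i, j) = (\<Sum>k<r. if k = j - 1 then (if j = 0 then 0 else M $$ (i, k)) else 0)"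
    unfolding mult_mat_entry[OF assms singular_pencil_carrier(1) ij]
    by (rule sum.cong) (use ij in \<open>auto simp: singular_pencil_def\<close>)
  also have "\<dots> = (if j = 0 then 0 else M $$ (i, j - 1))" using ij by (auto simp: sum.delta)
  finally show "(M * fst (singular_pencil r)) $$ (i, j) =
      mat p (r + 1) (\<lambda>(i, j). if j = 0 then 0 else M $$ (i, j - 1)) $$ (i, j)" using ij by simp
qed (use assms singular_pencil_carrier[of r] in auto)

lemma mult_singular_snd:
  assumes "M \<in> carrier_mat p r"
  shows "M * snd (singular_pencil r) = mat p (r + 1) (\<lambda>(i, j). if j < r then M $$ (i, j) else 0)"
proof (rule eq_matI)
  fix i j assume "i < dim_row (mat p (r + 1) (\<lambda>(i, j). if j < r then M $$ (i, j) else 0))"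
    "j < dim_col (mat p (r + 1) (\<lambda>(i, j). if j < r then M $$ (i, j) else 0))"
  then have ij: "i < p" "j < r + 1" by auto
  have "(M * snd (singular_pencil r)) $$ (i, j) = (\<Sum>k<r. if k = j then M $$ (i, k) else 0)"
    unfolding mult_mat_entry[OF assms singular_pencil_carrier(2) ij]
    by (rule sum.cong) (use ij in \<open>auto simp: singular_pencil_def\<close>)
  then show "(M * snd (singular_pencil r)) $$ (i, j) =
      mat p (r + 1) (\<lambda>(i, j). if j < r then M $$ (i, j) else 0) $$ (i, j)"
    using ij by (auto simp: sum.delta)
qed (use assms singular_pencil_carrier[of r] in auto)

lemma singular_fst_mult:
  assumes "M \<in> carrier_mat (r + 1) p"
  shows "fst (singular_pencil r) * M = mat r p (\<lambda>(i, j). M $$ (i + 1, j))"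
proof (rule eq_matI)
  fix i j assume "i < dim_row (mat r p (\<lambda>(i, j). M $$ (i + 1, j)))" "j < dim_col (mat r p (\<lambda>(i, j). M $$ (i + 1, j)))"
  then have ij: "i < r" "j < p" by auto
  have "(fst (singular_pencil r) * M) $$ (i, j) = (\<Sum>k<r+1. if k = i + 1 then M $$ (k, j) else 0)"
    unfolding mult_mat_entry[OF singular_pencil_carrier(1) assms ij]
    by (rule sum.cong) (use ij in \<open>auto simp: singular_pencil_def\<close>)
  then show "(fst (singular_pencil r) * M) $$ (i, j) = mat r p (\<lambda>(i, j). M $$ (i + 1, j)) $$ (i, j)"
    using ij by (auto simp: sum.delta)
qed (use assms singular_pencil_carrier[of r] in auto)

lemma singular_snd_mult:
  assumes "M \<in> carrier_mat (r + 1) p"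
  shows "snd (singular_pencil r) * M = mat r p (\<lambda>(i, j). M $$ (i, j))"
proof (rule eq_matI)
  fix i j assume "i < dim_row (mat r p (\<lambda>(i, j). M $$ (i, j)))" "j < dim_col (mat r p (\<lambda>(i, j). M $$ (i, j)))"
  then have ij: "i < r" "j < p" by auto
  have "(snd (singular_pencil r) * M) $$ (i, j) = (\<Sum>k<r+1. if k = i then M $$ (k, j) else 0)"
    unfolding mult_mat_entry[OF singular_pencil_carrier(2) assms ij]
    by (rule sum.cong) (use ij in \<open>auto simp: singular_pencil_def\<close>)
  then show "(snd (singular_pencil r) * M) $$ (i, j) = mat r p (\<lambda>(i, j). M $$ (i, j)) $$ (i, j)"
    using ij by (auto simp: sum.delta)
qed (use assms singular_pencil_carrier[of r] in auto)

lemma mult_transpose_singular: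
  assumes M: "M \<in> carrier_mat p (r + 1)"
  shows "M * transpose_mat (fst (singular_pencil r)) = mat p r (\<lambda>(i, j). M $$ (i, j + 1))"
    and "M * transpose_mat (snd (singular_pencil r)) = mat p r (\<lambda>(i, j). M $$ (i, j))"
proof -
  have *: "M * transpose_mat S = transpose_mat (S * transpose_mat M)" if "S \<in> carrier_mat r (r + 1)" for S
    using that M by (simp add: transpose_mult[of S r "r + 1"])
  show "M * transpose_mat (fst (singular_pencil r)) = mat p r (\<lambda>(i, j). M $$ (i, j + 1))"
    unfolding *[OF singular_pencil_carrier(1)] using M
    by (subst singular_fst_mult[of _ r p]) (auto intro!: eq_matI)
  show "M * transpose_mat (snd (singular_pencil r)) = mat p r (\<lambda>(i, j). M $$ (i, j))"
    unfolding *[OF singular_pencil_carrier(2)] using M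
    by (subst singular_snd_mult[of _ r p]) (auto intro!: eq_matI)
qed

lemma mult_jordan_block:
  fixes M :: "complex mat"
  assumes "M \<in> carrier_mat p r" "i < p" "j < r"
  shows "(M * jordan_block r z) $$ (i, j) = z * M $$ (i, j) + (if j = 0 then 0 else M $$ (i, j - 1))"
proof -
  have "(M * jordan_block r z) $$ (i, j) =
      (\<Sum>k<r. (if k = j then z * M $$ (i, k) else 0) + (if k = j - 1 then (if j = 0 then 0 else M $$ (i, k)) else 0))"
    unfolding mult_mat_entry[OF assms(1) jordan_block_carrier assms(2,3)]
    by (rule sum.cong) (use assms in auto)
  then show ?thesis using assms by (simp add: sum.distrib sum.delta)
qed

lemma jordan_block_mult:
  fixes M :: "complex mat"
  assumes "M \<in> carrier_mat r p" "i < r" "j < p"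
  shows "(jordan_block r z * M) $$ (i, j) = z * M $$ (i, j) + (if i + 1 < r then M $$ (i + 1, j) else 0)"
proof -
  have "(jordan_block r z * M) $$ (i, j) =
      (\<Sum>k<r. (if k = i then z * M $$ (k, j) else 0) + (if k = i + 1 then M $$ (k, j) else 0))"
    unfolding mult_mat_entry[OF jordan_block_carrier assms]
    by (rule sum.cong) (use assms in auto)
  then show ?thesis using assms by (simp add: sum.distrib sum.delta)
qed

lemma mat_fun_eq_iff: "mat p q f = mat p q g \<longleftrightarrow> (\<forall>i<p. \<forall>j<q. f (i, j) = g (i, j))"
proof
  assume e: "mat p q f = mat p q g"
  show "\<forall>i<p. \<forall>j<q. f (i, j) = g (i, j)"
  proof (intro allI impI)
    fix i j assume "i < p" "j < q"
    then have "mat p q f $$ (i, j) = f (i, j)" "mat p q g $$ (i, j) = g (i, j)" by auto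
    then show "f (i, j) = g (i, j)" by (simp add: e)
  qed
qed (auto intro: eq_matI)

lemma mult_zero_col:
  fixes M N :: "complex mat"
  assumes "M \<in> carrier_mat p q" "N \<in> carrier_mat q s" "i < p" "j < s" "\<And>k. k < q \<Longrightarrow> N $$ (k, j) = 0"
  shows "(M * N) $$ (i, j) = 0"
  unfolding mult_mat_entry[OF assms(1-4)] by (rule sum.neutral) (use assms(5) in auto)

section \<open>Morphisms from and between singular blocks\<close>

lemma block_SingLT: "block_pencil (SingLT r) = transpose_pencil (singular_pencil r)"
  by (simp add: transpose_pencil_def)

lemma singular_pencil_in_carrier: "singular_pencil r \<in> pencil_carrier r (r + 1)"
  using singular_pencil_carrier[of r] by (cases "singular_pencil r") auto

text \<open>Written column by column, a morphism from \<open>L\<^sub>r\<^sup>T\<close> is a chain \<open>y\<^sub>0, \<dots>, y\<^sub>r\<close> in which each step from \<open>y\<^sub>j\<close> to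
  \<open>y\<^sub>j\<^sub>+\<^sub>1\<close> is a vector \<open>x\<^sub>j\<close> with images \<open>B x\<^sub>j = y\<^sub>j\<close> and \<open>A x\<^sub>j = y\<^sub>j\<^sub>+\<^sub>1\<close>.\<close>

lemma hom_SingLT_iff:
  assumes "A \<in> carrier_mat N N" "B \<in> carrier_mat N N"
  shows "(Y, X) \<in> pencil_hom (block_pencil (SingLT r)) (A, B) \<longleftrightarrow>
    Y \<in> carrier_mat N (r + 1) \<and> X \<in> carrier_mat N r \<and>
    (\<forall>j<r. A *\<^sub>v col X j = col Y (j + 1) \<and> B *\<^sub>v col X j = col Y j)"
proof -
  have "Y * transpose_mat (fst (singular_pencil r)) = A * X \<and>
        Y * transpose_mat (snd (singular_pencil r)) = B * X \<longleftrightarrow>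
    (\<forall>j<r. A *\<^sub>v col X j = col Y (j + 1) \<and> B *\<^sub>v col X j = col Y j)" (is "?L = ?R")
    if c: "Y \<in> carrier_mat N (r + 1)" "X \<in> carrier_mat N r"
  proof -
    have *: "mat N r (\<lambda>(i, j). Y $$ (i, f j)) = M * X \<longleftrightarrow> (\<forall>j<r. M *\<^sub>v col X j = col Y (f j))"
      if "M \<in> carrier_mat N N" "\<forall>j<r. f j < r + 1" for M f
    proof
      assume e: "mat N r (\<lambda>(i, j). Y $$ (i, f j)) = M * X"
      show "\<forall>j<r. M *\<^sub>v col X j = col Y (f j)"
      proof (intro allI impI eq_vecI)
        fix j i assume "j < r" "i < dim_vec (col Y (f j))"
        then show "(M *\<^sub>v col X j) $ i = col Y (f j) $ i"
          using arg_cong[OF e, of "\<lambda>M. M $$ (i, j)"] c that by auto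
      qed (use c that in auto)
    next
      assume e: "\<forall>j<r. M *\<^sub>v col X j = col Y (f j)"
      show "mat N r (\<lambda>(i, j). Y $$ (i, f j)) = M * X"
      proof (rule eq_matI)
        fix i j assume "i < dim_row (M * X)" "j < dim_col (M * X)"
        then show "mat N r (\<lambda>(i, j). Y $$ (i, f j)) $$ (i, j) = (M * X) $$ (i, j)"
          using arg_cong[OF e[rule_format, of j], of "\<lambda>v. v $ i"] c that by auto
      qed (use c that in auto)
    qed
    show ?thesis
      unfolding mult_transpose_singular[OF c(1)]
      using *[OF assms(1), of "\<lambda>j. j + 1"] *[OF assms(2), of "\<lambda>j. j"] by auto
  qed
  then show ?thesis
    using assms singular_pencil_carrier[of r] by (auto simp: pencil_hom_def)
qed

text \<open>When \<open>B\<close> is the identity, the chain is the Krylov sequence \<open>y\<^sub>j = A\<^sup>j y\<^sub>0\<close>, and its first column \<open>y\<^sub>0\<close> can be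
  chosen freely. This covers the Jordan blocks of finite eigenvalues and their transposes.\<close>

lemma hom_dim_SingLT_fst:
  assumes A: "A \<in> carrier_mat N N"
  shows "hom_dim (block_pencil (SingLT r)) (A, 1\<^sub>m N) N"
proof -
  define y where "y h j = ((\<lambda>v. A *\<^sub>v v) ^^ j) (vec N h)" for h :: "nat \<Rightarrow> complex" and j
  have y0: "y h 0 = vec N h" and ySuc: "y h (Suc j) = A *\<^sub>v y h j" for h j
    by (auto simp: y_def)
  have y_carrier: "y h j \<in> carrier_vec N" for h j
    by (induction j) (use A in \<open>auto simp: y0 ySuc\<close>)
  have y_lin: "y (\<lambda>k. a * g k + h k) j = a \<cdot>\<^sub>v y g j + y h j" for a g h j
  proof (induction j)
    case 0 then show ?case by (auto simp: y0)
  next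
    case (Suc j)
    show ?case unfolding ySuc Suc
      using A y_carrier by (simp add: mult_add_distrib_mat_vec[of _ N N] mult_mat_vec)
  qed
  define \<Psi> where "\<Psi> h = (mat N (r + 1) (\<lambda>(i, j). y h j $ i), mat N r (\<lambda>(i, j). y h j $ i))" for h
  have cols: "col (mat N m (\<lambda>(i, j). y h j $ i)) j = y h j" if "j < m" for m h j
    using that y_carrier[of h j] by (intro eq_vecI) auto
  let ?H = "pencil_hom (block_pencil (SingLT r)) (A, 1\<^sub>m N)"
  note iff = hom_SingLT_iff[OF A one_carrier_mat, of _ _ r]
  have mem: "\<Psi> h \<in> ?H" for h
    unfolding \<Psi>_def iff using y_carrier by (auto simp: cols ySuc simp del: col_mat)
  have onto: "\<exists>h. u = \<Psi> h" if u: "u \<in> ?H" for u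
  proof -
    obtain Y X where u_eq: "u = (Y, X)" by force
    have YX: "Y \<in> carrier_mat N (r + 1)" "X \<in> carrier_mat N r"
      "\<And>j. j < r \<Longrightarrow> A *\<^sub>v col X j = col Y (j + 1)" "\<And>j. j < r \<Longrightarrow> col X j = col Y j"
      using u unfolding u_eq iff by (auto simp: col_dim)
    define h where "h = (\<lambda>i. Y $$ (i, 0))"
    have Yc: "col Y j = y h j" if "j \<le> r" for j
      using that
    proof (induction j)
      case 0 then show ?case using YX by (auto simp: y0 h_def)
    next
      case (Suc j) then show ?case using YX(3,4)[of j] by (simp add: ySuc)
    qed
    have "Y = fst (\<Psi> h)"
    proof (rule eq_matI)
      fix i j assume "i < dim_row (fst (\<Psi> h))" "j < dim_col (fst (\<Psi> h))"
      then show "Y $$ (i, j) = fst (\<Psi> h) $$ (i, j)"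
        using YX arg_cong[OF Yc[of j], of "\<lambda>v. v $ i"] by (auto simp: \<Psi>_def)
    qed (use YX in \<open>auto simp: \<Psi>_def\<close>)
    moreover have "X = snd (\<Psi> h)"
    proof (rule eq_matI)
      fix i j assume "i < dim_row (snd (\<Psi> h))" "j < dim_col (snd (\<Psi> h))"
      then have ij: "i < N" "j < r" by (auto simp: \<Psi>_def)
      then have "col X j = y h j" using YX(4)[of j] Yc[of j] by simp
      moreover have "X $$ (i, j) = col X j $ i" using YX(2) ij by simp
      ultimately show "X $$ (i, j) = snd (\<Psi> h) $$ (i, j)"
        using ij by (simp add: \<Psi>_def)
    qed (use YX in \<open>auto simp: \<Psi>_def\<close>)
    ultimately show ?thesis unfolding u_eq by (metis prod.collapse)
  qed
  have inj: "\<Psi> g = \<Psi> h \<longleftrightarrow> (\<forall>k<N. g k = h k)" for g h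
  proof
    assume e: "\<Psi> g = \<Psi> h"
    have "y g 0 = y h 0" using e cols[of 0 "r + 1" g] cols[of 0 "r + 1" h] by (auto simp: \<Psi>_def)
    then show "\<forall>k<N. g k = h k" unfolding y0 by (metis index_vec)
  next
    assume "\<forall>k<N. g k = h k"
    then have "vec N g = vec N h" by auto
    then show "\<Psi> g = \<Psi> h" by (simp add: \<Psi>_def y_def)
  qed
  have lin: "\<Psi> (\<lambda>k. a * g k + h k) = pair_lincomb a (\<Psi> g) (\<Psi> h)" for a g h
    using y_carrier[THEN carrier_vecD] by (auto simp: \<Psi>_def pair_lincomb_def y_lin intro!: eq_matI)
  have "linear_chart \<Psi> N ?H"
    unfolding linear_chart_def using mem onto inj lin by blast
  then show ?thesis by (auto simp: hom_dim_def)
qed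

text \<open>Read backwards, a chain for \<open>(A, B)\<close> becomes a chain for \<open>(B, A)\<close>. This reduces blocks of the
  eigenvalue \<open>\<infinity>\<close> to the case of finite eigenvalues.\<close>

definition reverse_cols :: "complex mat \<Rightarrow> complex mat" where
  "reverse_cols M = mat (dim_row M) (dim_col M) (\<lambda>(i, j). M $$ (i, dim_col M - 1 - j))"

lemma dim_reverse_cols [simp]:
  "dim_row (reverse_cols M) = dim_row M" "dim_col (reverse_cols M) = dim_col M"
  by (simp_all add: reverse_cols_def)

lemma reverse_cols_carrier [simp]: "reverse_cols M \<in> carrier_mat p q \<longleftrightarrow> M \<in> carrier_mat p q"
  unfolding carrier_mat_def by simp

lemma reverse_cols_index [simp]:
  "i < dim_row M \<Longrightarrow> j < dim_col M \<Longrightarrow> reverse_cols M $$ (i, j) = M $$ (i, dim_col M - 1 - j)"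
  by (simp add: reverse_cols_def)

lemma reverse_cols_reverse_cols [simp]: "reverse_cols (reverse_cols M) = M"
  by (rule eq_matI) auto

lemma col_reverse_cols: "M \<in> carrier_mat p q \<Longrightarrow> j < q \<Longrightarrow> col (reverse_cols M) j = col M (q - 1 - j)"
  by (rule eq_vecI) auto

lemma hom_dim_SingLT_snd:
  assumes B: "B \<in> carrier_mat N N"
  shows "hom_dim (block_pencil (SingLT r)) (1\<^sub>m N, B) N"
proof -
  let ?\<phi> = "\<lambda>(Y, X). (reverse_cols Y, reverse_cols X)"
  let ?H = "\<lambda>A B. pencil_hom (block_pencil (SingLT r)) (A, B)"
  have rev: "?\<phi> u \<in> ?H B' A'"
    if u: "u \<in> ?H A' B'" and c: "A' \<in> carrier_mat N N" "B' \<in> carrier_mat N N" for u A' B'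
  proof -
    obtain Y X where u_eq: "u = (Y, X)" by force
    have YX: "Y \<in> carrier_mat N (r + 1)" "X \<in> carrier_mat N r"
      "\<And>j. j < r \<Longrightarrow> A' *\<^sub>v col X j = col Y (j + 1)" "\<And>j. j < r \<Longrightarrow> B' *\<^sub>v col X j = col Y j"
      using u unfolding u_eq hom_SingLT_iff[OF c] by auto
    show ?thesis unfolding u_eq prod.case hom_SingLT_iff[OF c(2,1)]
    proof (intro conjI allI impI)
      fix j assume j: "j < r"
      then show "B' *\<^sub>v col (reverse_cols X) j = col (reverse_cols Y) (j + 1)"
        using YX(4)[of "r - 1 - j"] by (simp add: col_reverse_cols[OF YX(1)] col_reverse_cols[OF YX(2)])
      have "r - 1 - j + 1 = r - j" using j by simp
      then show "A' *\<^sub>v col (reverse_cols X) j = col (reverse_cols Y) j"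
        using YX(3)[of "r - 1 - j"] j by (simp add: col_reverse_cols[OF YX(1)] col_reverse_cols[OF YX(2)])
    qed (use YX in simp_all)
  qed
  show ?thesis
  proof (rule hom_dim_transport[OF hom_dim_SingLT_fst[OF B], where \<phi> = ?\<phi>])
    show "bij_betw ?\<phi> (?H B (1\<^sub>m N)) (?H (1\<^sub>m N) B)"
      by (rule bij_betw_byWitness[where f' = ?\<phi>]) (use B rev in auto)
  next
    fix a u v assume "u \<in> ?H B (1\<^sub>m N)" "v \<in> ?H B (1\<^sub>m N)"
    moreover have "reverse_cols (a \<cdot>\<^sub>m U + V) = a \<cdot>\<^sub>m reverse_cols U + reverse_cols V"
      if "U \<in> carrier_mat p q" "V \<in> carrier_mat p q" for U V p q
      using that by (intro eq_matI) auto
    ultimately show "?\<phi> (pair_lincomb a u v) = pair_lincomb a (?\<phi> u) (?\<phi> v)"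
      by (cases u, cases v) (auto simp: hom_SingLT_iff[OF B one_carrier_mat] pair_lincomb_def simp del: block_pencil.simps)
  qed
qed

text \<open>A morphism from \<open>L\<^sub>r\<close> is a chain \<open>x\<^sub>0, \<dots>, x\<^sub>r\<close> with \<open>A x\<^sub>0 = 0\<close>, \<open>A x\<^sub>j\<^sub>+\<^sub>1 = y\<^sub>j = B x\<^sub>j\<close> and \<open>B x\<^sub>r = 0\<close>. If \<open>A\<close> is
  injective, the chain vanishes from left to right, starting with \<open>x\<^sub>0\<close>.\<close>

lemma hom_dim_SingL_left_invertible_fst:
  assumes A: "A \<in> carrier_mat p q" and B: "B \<in> carrier_mat p q" and C: "C \<in> carrier_mat q p" "C * A = 1\<^sub>m q"
  shows "hom_dim (block_pencil (SingL r)) (A, B) 0"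
proof -
  have "Y = 0\<^sub>m p r \<and> X = 0\<^sub>m q (r + 1)"
    if Y: "Y \<in> carrier_mat p r" and X: "X \<in> carrier_mat q (r + 1)"
      and e: "Y * fst (singular_pencil r) = A * X" "Y * snd (singular_pencil r) = B * X" for Y X
  proof -
    have "X = C * (A * X)" using A C X assoc_mult_mat[of C q p A q X "r + 1"] by simp
    also have "\<dots> = (C * Y) * fst (singular_pencil r)"
      using e(1) assoc_mult_mat[OF C(1) Y singular_pencil_carrier(1)] by simp
    finally have X_eq: "X = mat q (r + 1) (\<lambda>(i, j). if j = 0 then 0 else (C * Y) $$ (i, j - 1))"
      using mult_singular_fst[of "C * Y" q r] C Y by simp
    have step: "Y $$ (i, j) = 0" if "\<And>i. i < q \<Longrightarrow> X $$ (i, j) = 0" "j < r" "i < p" for i j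
    proof -
      have "(B * X) $$ (i, j) = 0" using mult_zero_col[OF B X, of i j] that by simp
      moreover have "(B * X) $$ (i, j) = Y $$ (i, j)"
        unfolding e(2)[symmetric] mult_singular_snd[OF Y] using that by simp
      ultimately show ?thesis by simp
    qed
    have X0: "X $$ (i, j) = 0" if "i < q" "j \<le> r" for i j
      using that
    proof (induction j arbitrary: i)
      case 0 then show ?case by (subst X_eq) simp
    next
      case (Suc j)
      then have "(C * Y) $$ (i, j) = 0"
        using mult_zero_col[OF C(1) Y, of i j] step[of j] by simp
      then show ?case using Suc by (subst X_eq) simp
    qed
    then show ?thesis using X Y step by (auto intro!: eq_matI)
  qed
  then show ?thesis
    using hom_dim_0I[of "fst (singular_pencil r)" "snd (singular_pencil r)" r "r + 1" A B p q] A B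
      singular_pencil_in_carrier[of r] by simp
qed

text \<open>If \<open>B\<close> is injective, the chain vanishes from right to left, starting with \<open>x\<^sub>r\<close>.\<close>

lemma hom_dim_SingL_left_invertible_snd:
  assumes A: "A \<in> carrier_mat p q" and B: "B \<in> carrier_mat p q" and C: "C \<in> carrier_mat q p" "C * B = 1\<^sub>m q"
  shows "hom_dim (block_pencil (SingL r)) (A, B) 0"
proof -
  have "Y = 0\<^sub>m p r \<and> X = 0\<^sub>m q (r + 1)"
    if Y: "Y \<in> carrier_mat p r" and X: "X \<in> carrier_mat q (r + 1)"
      and e: "Y * fst (singular_pencil r) = A * X" "Y * snd (singular_pencil r) = B * X" for Y X
  proof -
    have "X = C * (B * X)" using B C X assoc_mult_mat[of C q p B q X "r + 1"] by simp
    also have "\<dots> = (C * Y) * snd (singular_pencil r)"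
      using e(2) assoc_mult_mat[OF C(1) Y singular_pencil_carrier(2)] by simp
    finally have X_eq: "X = mat q (r + 1) (\<lambda>(i, j). if j < r then (C * Y) $$ (i, j) else 0)"
      using mult_singular_snd[of "C * Y" q r] C Y by simp
    have step: "Y $$ (i, j) = 0" if "\<And>i. i < q \<Longrightarrow> X $$ (i, j + 1) = 0" "j < r" "i < p" for i j
    proof -
      have "(A * X) $$ (i, j + 1) = 0" using mult_zero_col[OF A X, of i "j + 1"] that by simp
      moreover have "(A * X) $$ (i, j + 1) = Y $$ (i, j)"
        unfolding e(1)[symmetric] mult_singular_fst[OF Y] using that by simp
      ultimately show ?thesis by simp
    qed
    have X0: "X $$ (i, r - j) = 0" if "i < q" "j \<le> r" for i j
      using that
    proof (induction j arbitrary: i)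
      case 0 then show ?case by (subst X_eq) simp
    next
      case (Suc j)
      then have "r - j = r - Suc j + 1" by simp
      then have "(C * Y) $$ (i, r - Suc j) = 0"
        using Suc mult_zero_col[OF C(1) Y, of i "r - Suc j"] step[of "r - Suc j"] by simp
      then show ?case using Suc by (subst X_eq) simp
    qed
    have X0': "X $$ (i, j) = 0" if "i < q" "j \<le> r" for i j
      using X0[of i "r - j"] that by simp
    then show ?thesis using X Y step by (auto intro!: eq_matI)
  qed
  then show ?thesis
    using hom_dim_0I[of "fst (singular_pencil r)" "snd (singular_pencil r)" r "r + 1" A B p q] A B
      singular_pencil_in_carrier[of r] by simp
qed

text \<open>The equations say that \<open>X\<close> and \<open>Y\<close> are constant along antidiagonals with a common sequence of values,
  so that the morphisms are pairs of Hankel matrices. The \<open>r + s\<close> antidiagonals of \<open>X\<close> and \<open>Y\<close> together give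
  the coordinates; both matrices are needed, as \<open>Y\<close> is empty for \<open>s = 0\<close> and \<open>X\<close> for \<open>r = 0\<close>.\<close>

lemma hom_dim_SingLT_SingL: "hom_dim (block_pencil (SingLT r)) (block_pencil (SingL s)) (r + s)"
proof -
  let ?H = "pencil_hom (block_pencil (SingLT r)) (block_pencil (SingL s))"
  have iff: "(Y, X) \<in> ?H \<longleftrightarrow> Y \<in> carrier_mat s (r + 1) \<and> X \<in> carrier_mat (s + 1) r \<and>
      (\<forall>i<s. \<forall>j<r. Y $$ (i, j + 1) = X $$ (i + 1, j)) \<and> (\<forall>i<s. \<forall>j<r. Y $$ (i, j) = X $$ (i, j))" for Y X
    using singular_pencil_carrier[of r] singular_pencil_carrier[of s]
    by (auto simp: pencil_hom_def mult_transpose_singular singular_fst_mult singular_snd_mult mat_fun_eq_iff)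
  define \<Psi> where "\<Psi> h = (mat s (r + 1) (\<lambda>(i, j). h (i + j)), mat (s + 1) r (\<lambda>(i, j). h (i + j)))"
    for h :: "nat \<Rightarrow> complex"
  have mem: "\<Psi> h \<in> ?H" for h unfolding \<Psi>_def iff by simp
  have onto: "\<exists>h. u = \<Psi> h" if u: "u \<in> ?H" for u
  proof -
    obtain Y X where u_eq: "u = (Y, X)" by force
    have YX: "Y \<in> carrier_mat s (r + 1)" "X \<in> carrier_mat (s + 1) r"
      "\<And>i j. i < s \<Longrightarrow> j < r \<Longrightarrow> Y $$ (i, j + 1) = X $$ (i + 1, j)"
      "\<And>i j. i < s \<Longrightarrow> j < r \<Longrightarrow> Y $$ (i, j) = X $$ (i, j)"
      using u unfolding u_eq iff by auto
    \<comment> \<open>The first column of \<open>Y\<close> meets the antidiagonals below \<open>s\<close>, the last row of \<open>X\<close> the others.\<close>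
    define h where "h = (\<lambda>k. if k < s then Y $$ (k, 0) else X $$ (s, k - s))"
    have Y_eq: "Y $$ (i, j) = h (i + j)" if "i < s" "j \<le> r" for i j
      using that
    proof (induction j arbitrary: i)
      case 0 then show ?case by (simp add: h_def)
    next
      case (Suc j)
      show ?case
      proof (cases "i + 1 < s")
        case True
        then show ?thesis using YX(3)[of i j] YX(4)[of "i + 1" j] Suc.IH[of "i + 1"] Suc.prems by simp
      next
        case False
        then have "s = i + 1" using Suc.prems by simp
        then show ?thesis using YX(3)[of i j] Suc.prems by (simp add: h_def)
      qed
    qed
    have X_eq: "X $$ (i, j) = h (i + j)" if "i \<le> s" "j < r" for i j
      using that Y_eq[of i j] YX(4)[of i j] by (cases "i < s") (auto simp: h_def)
    have "Y = fst (\<Psi> h)" "X = snd (\<Psi> h)"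
      using YX(1,2) Y_eq X_eq by (auto simp: \<Psi>_def intro!: eq_matI)
    then show ?thesis unfolding u_eq by (metis prod.collapse)
  qed
  have inj: "\<Psi> g = \<Psi> h \<longleftrightarrow> (\<forall>k<r + s. g k = h k)" for g h
  proof
    assume "\<Psi> g = \<Psi> h"
    then have e: "\<forall>i<s. \<forall>j<r+1. g (i + j) = h (i + j)" "\<forall>i<s+1. \<forall>j<r. g (i + j) = h (i + j)"
      by (simp_all add: \<Psi>_def mat_fun_eq_iff)
    show "\<forall>k<r + s. g k = h k"
    proof (intro allI impI)
      fix k assume "k < r + s"
      then show "g k = h k" using e(1)[rule_format, of k 0] e(2)[rule_format, of s "k - s"] by (cases "k < s") auto
    qed
  qed (auto simp: \<Psi>_def mat_fun_eq_iff)
  have lin: "\<Psi> (\<lambda>k. a * g k + h k) = pair_lincomb a (\<Psi> g) (\<Psi> h)" for a g h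
    by (auto simp: \<Psi>_def pair_lincomb_def intro!: eq_matI)
  have "linear_chart \<Psi> (r + s) ?H"
    unfolding linear_chart_def using mem onto inj lin by blast
  then show ?thesis by (auto simp: hom_dim_def)
qed

text \<open>Here \<open>X\<close> is constant along diagonals, and the conditions \<open>X(i + 1, 0) = 0\<close> and \<open>X(i, r) = 0\<close> for \<open>i < s\<close>
  leave only the diagonals \<open>j - i \<in> {0..r - s}\<close>. These are the banded Toeplitz matrices that represent
  multiplication by a polynomial of degree at most \<open>r - s\<close>.\<close>

lemma hom_dim_SingL_SingL: "hom_dim (block_pencil (SingL r)) (block_pencil (SingL s)) (r + 1 - s)"
proof -
  let ?H = "pencil_hom (block_pencil (SingL r)) (block_pencil (SingL s))"
  have iff: "(Y, X) \<in> ?H \<longleftrightarrow> Y \<in> carrier_mat s r \<and> X \<in> carrier_mat (s + 1) (r + 1) \<and>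
      (\<forall>i<s. \<forall>j<r+1. (if j = 0 then 0 else Y $$ (i, j - 1)) = X $$ (i + 1, j)) \<and>
      (\<forall>i<s. \<forall>j<r+1. (if j < r then Y $$ (i, j) else 0) = X $$ (i, j))" for Y X
  proof -
    have "Y * fst (singular_pencil r) = fst (singular_pencil s) * X \<and>
        Y * snd (singular_pencil r) = snd (singular_pencil s) * X \<longleftrightarrow>
      (\<forall>i<s. \<forall>j<r+1. (if j = 0 then 0 else Y $$ (i, j - 1)) = X $$ (i + 1, j)) \<and>
      (\<forall>i<s. \<forall>j<r+1. (if j < r then Y $$ (i, j) else 0) = X $$ (i, j))"
      if Y: "Y \<in> carrier_mat s r" and X: "X \<in> carrier_mat (s + 1) (r + 1)"
      unfolding mult_singular_fst[OF Y] mult_singular_snd[OF Y] singular_fst_mult[OF X]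
        singular_snd_mult[OF X] mat_fun_eq_iff by simp
    moreover have "(Y, X) \<in> ?H \<longleftrightarrow> Y \<in> carrier_mat s r \<and> X \<in> carrier_mat (s + 1) (r + 1) \<and>
        Y * fst (singular_pencil r) = fst (singular_pencil s) * X \<and>
        Y * snd (singular_pencil r) = snd (singular_pencil s) * X"
      using carrier_matD[OF singular_pencil_carrier(1)[of r]] carrier_matD[OF singular_pencil_carrier(1)[of s]]
      by (simp add: pencil_hom_def)
    ultimately show ?thesis by blast
  qed
  define f where "f h i j = (if i \<le> j \<and> j - i < r + 1 - s then h (j - i) else 0)"
    for h :: "nat \<Rightarrow> complex" and i j :: nat
  define \<Psi> where "\<Psi> h = (mat s r (\<lambda>(i, j). f h i j), mat (s + 1) (r + 1) (\<lambda>(i, j). f h i j))" for h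
  have mem: "\<Psi> h \<in> ?H" for h unfolding \<Psi>_def iff by (auto simp: f_def)
  have onto: "\<exists>h. u = \<Psi> h" if u: "u \<in> ?H" for u
  proof -
    obtain Y X where u_eq: "u = (Y, X)" by force
    have c: "Y \<in> carrier_mat s r" "X \<in> carrier_mat (s + 1) (r + 1)"
      and eA: "\<And>i j. i < s \<Longrightarrow> j < r + 1 \<Longrightarrow> (if j = 0 then 0 else Y $$ (i, j - 1)) = X $$ (i + 1, j)"
      and eB: "\<And>i j. i < s \<Longrightarrow> j < r + 1 \<Longrightarrow> (if j < r then Y $$ (i, j) else 0) = X $$ (i, j)"
      using u unfolding u_eq iff by blast+
    have diag: "X $$ (i + k, j + k) = X $$ (i, j)" if "i + k \<le> s" "j + k \<le> r" for i j k
      using that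
    proof (induction k)
      case (Suc k)
      then show ?case using eA[of "i + k" "j + k + 1"] eB[of "i + k" "j + k"] by simp
    qed simp
    have left: "X $$ (i, 0) = 0" if "0 < i" "i \<le> s" for i
      using eA[of "i - 1" 0] that by simp
    define h where "h = (\<lambda>k. X $$ (0, k))"
    have X_eq: "X $$ (i, j) = f h i j" if ij: "i \<le> s" "j \<le> r" for i j
    proof -
      consider "j < i" | "i \<le> j" "j - i < r + 1 - s" | "i \<le> j" "j - i \<ge> r + 1 - s" by linarith
      then show ?thesis
      proof cases
        case 1
        then show ?thesis
          using diag[of "i - j" j 0] left[of "i - j"] ij by (simp add: f_def)
      next
        case 2
        then show ?thesis using diag[of 0 i "j - i"] ij by (simp add: f_def h_def)
      next
        case 3
        \<comment> \<open>This diagonal leaves \<open>X\<close> through its last column, above the last row, where the entries are zero.\<close>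
        let ?k = "r - j"
        have "X $$ (i + ?k, j + ?k) = X $$ (i, j)" using diag[of i ?k j] 3 ij by simp
        moreover have "X $$ (i + ?k, r) = 0" using eB[of "i + ?k" r] 3 ij by simp
        ultimately show ?thesis using 3 ij by (simp add: f_def)
      qed
    qed
    have Y_eq: "Y $$ (i, j) = f h i j" if "i < s" "j < r" for i j
      using that eB[of i j] X_eq[of i j] by simp
    have "Y = fst (\<Psi> h)" "X = snd (\<Psi> h)"
      using c Y_eq X_eq by (auto simp: \<Psi>_def intro!: eq_matI)
    then show ?thesis unfolding u_eq by (metis prod.collapse)
  qed
  have inj: "\<Psi> g = \<Psi> h \<longleftrightarrow> (\<forall>k<r + 1 - s. g k = h k)" for g h
  proof
    assume "\<Psi> g = \<Psi> h"
    then have e: "\<forall>i<s+1. \<forall>j<r+1. f g i j = f h i j"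
      by (simp add: \<Psi>_def mat_fun_eq_iff)
    show "\<forall>k<r + 1 - s. g k = h k"
    proof (intro allI impI)
      fix k assume "k < r + 1 - s"
      then show "g k = h k" using e[rule_format, of 0 k] by (simp add: f_def)
    qed
  qed (auto simp: \<Psi>_def mat_fun_eq_iff f_def)
  have lin: "\<Psi> (\<lambda>k. a * g k + h k) = pair_lincomb a (\<Psi> g) (\<Psi> h)" for a g h
    by (auto simp: \<Psi>_def pair_lincomb_def f_def intro!: eq_matI)
  have "linear_chart \<Psi> (r + 1 - s) ?H"
    unfolding linear_chart_def using mem onto inj lin by blast
  then show ?thesis by (auto simp: hom_dim_def)
qed

section \<open>Morphisms between Jordan blocks\<close>

text \<open>The identity as second component forces \<open>Y = X\<close>, so a morphism between Jordan blocks is a matrix that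
  intertwines them.\<close>

lemma hom_jordan_iff:
  "(Y, X) \<in> pencil_hom (block_pencil (JordanFin r z)) (block_pencil (JordanFin s w)) \<longleftrightarrow>
    Y = X \<and> X \<in> carrier_mat s r \<and> (\<forall>i<s. \<forall>j<r. z * X $$ (i, j) + (if j = 0 then 0 else X $$ (i, j - 1)) =
      w * X $$ (i, j) + (if i + 1 < s then X $$ (i + 1, j) else 0))"
proof -
  have "X * jordan_block r z = jordan_block s w * X \<longleftrightarrow>
      (\<forall>i<s. \<forall>j<r. z * X $$ (i, j) + (if j = 0 then 0 else X $$ (i, j - 1)) =
      w * X $$ (i, j) + (if i + 1 < s then X $$ (i + 1, j) else 0))" if X: "X \<in> carrier_mat s r"
  proof -
    have "X * jordan_block r z = jordan_block s w * X \<longleftrightarrow>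
        (\<forall>i<s. \<forall>j<r. (X * jordan_block r z) $$ (i, j) = (jordan_block s w * X) $$ (i, j))"
      using X unfolding mat_eq_iff by (auto simp del: index_mult_mat(1))
    then show ?thesis using mult_jordan_block[OF X] jordan_block_mult[OF X] by simp
  qed
  moreover have "(Y, X) \<in> pencil_hom (block_pencil (JordanFin r z)) (block_pencil (JordanFin s w)) \<longleftrightarrow>
      Y = X \<and> X \<in> carrier_mat s r \<and> X * jordan_block r z = jordan_block s w * X"
  proof (cases "Y \<in> carrier_mat s r \<and> X \<in> carrier_mat s r")
    case True
    then have "Y * 1\<^sub>m r = Y" "1\<^sub>m s * X = X" by auto
    with True show ?thesis by (auto simp: pencil_hom_def)
  qed (auto simp: pencil_hom_def)
  ultimately show ?thesis by blast
qed

text \<open>The intertwiners of two nilpotent shifts are upper triangular Toeplitz matrices pressed into the top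
  right corner. The diagonals are numbered by their distance \<open>r - 1 - j + i\<close> from that corner; only the
  first \<open>min r s\<close> of them avoid the entries that the boundary equations force to vanish.\<close>

lemma hom_dim_jordan_eq:
  "hom_dim (block_pencil (JordanFin r z)) (block_pencil (JordanFin s z)) (min r s)"
proof -
  let ?H = "pencil_hom (block_pencil (JordanFin r z)) (block_pencil (JordanFin s z))"
  define f where "f h i j = (if r - 1 - j + i < min r s then h (r - 1 - j + i) else 0)"
    for h :: "nat \<Rightarrow> complex" and i j :: nat
  define \<Psi> where "\<Psi> h = (mat s r (\<lambda>(i, j). f h i j), mat s r (\<lambda>(i, j). f h i j))" for h
  have mem: "\<Psi> h \<in> ?H" for h
  proof -
    have e: "(if j = 0 then 0 else f h i (j - 1)) = (if i + 1 < s then f h (i + 1) j else 0)"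
      if "i < s" "j < r" for i j
    proof -
      have "r - 1 - (j - 1) + i = r - 1 - j + (i + 1)" if "j \<noteq> 0" using that \<open>j < r\<close> by simp
      then show ?thesis using that by (auto simp: f_def)
    qed
    show ?thesis unfolding \<Psi>_def hom_jordan_iff
    proof (intro conjI allI impI)
      fix i j assume "i < s" "j < r"
      then show "z * mat s r (\<lambda>(i, j). f h i j) $$ (i, j) +
          (if j = 0 then 0 else mat s r (\<lambda>(i, j). f h i j) $$ (i, j - 1)) =
        z * mat s r (\<lambda>(i, j). f h i j) $$ (i, j) +
          (if i + 1 < s then mat s r (\<lambda>(i, j). f h i j) $$ (i + 1, j) else 0)"
        using e[of i j] by (cases "j = 0"; cases "i + 1 < s"; simp)
    qed simp_all
  qed
  have onto: "\<exists>h. u = \<Psi> h" if u: "u \<in> ?H" for u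
  proof -
    obtain X where u_eq: "u = (X, X)" and X: "X \<in> carrier_mat s r"
      and e: "\<And>i j. i < s \<Longrightarrow> j < r \<Longrightarrow>
        (if j = 0 then 0 else X $$ (i, j - 1)) = (if i + 1 < s then X $$ (i + 1, j) else 0)"
      using u by (cases u) (simp add: hom_jordan_iff del: block_pencil.simps)
    have diag: "X $$ (i + k, j + k) = X $$ (i, j)" if "i + k < s" "j + k < r" for i j k
      using that
    proof (induction k)
      case (Suc k)
      then show ?case using e[of "i + k" "j + k + 1"] by simp
    qed simp
    have left: "X $$ (i, 0) = 0" if "0 < i" "i < s" "0 < r" for i
      using e[of "i - 1" 0] that by simp
    \<comment> \<open>The last column meets every diagonal that need not vanish.\<close>
    define h where "h = (\<lambda>k. X $$ (k, r - 1))"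
    have X_eq: "X $$ (i, j) = f h i j" if ij: "i < s" "j < r" for i j
    proof -
      let ?m = "r - 1 - j + i"
      consider "?m < min r s" | "r \<le> ?m" | "s \<le> ?m" by linarith
      then show ?thesis
      proof cases
        case 1
        then show ?thesis using diag[of i "r - 1 - j" j] ij by (simp add: f_def h_def add.commute)
      next
        case 2
        then show ?thesis using diag[of "i - j" j 0] left[of "i - j"] ij by (simp add: f_def)
      next
        case 3
        then show ?thesis using diag[of i "s - 1 - i" j] e[of "s - 1" "j + (s - 1 - i) + 1"] ij
          by (simp add: f_def)
      qed
    qed
    have "X = fst (\<Psi> h)" using X X_eq by (auto simp: \<Psi>_def intro!: eq_matI)
    then show ?thesis by (auto simp: u_eq \<Psi>_def)
  qed
  have inj: "\<Psi> g = \<Psi> h \<longleftrightarrow> (\<forall>k<min r s. g k = h k)" for g h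
  proof
    assume "\<Psi> g = \<Psi> h"
    then have e: "\<forall>i<s. \<forall>j<r. f g i j = f h i j" by (simp add: \<Psi>_def mat_fun_eq_iff)
    show "\<forall>k<min r s. g k = h k"
    proof (intro allI impI)
      fix k assume "k < min r s"
      then show "g k = h k" using e[rule_format, of k "r - 1"] by (simp add: f_def)
    qed
  qed (auto simp: \<Psi>_def mat_fun_eq_iff f_def)
  have lin: "\<Psi> (\<lambda>k. a * g k + h k) = pair_lincomb a (\<Psi> g) (\<Psi> h)" for a g h
    by (auto simp: \<Psi>_def pair_lincomb_def f_def intro!: eq_matI)
  have "linear_chart \<Psi> (min r s) ?H"
    unfolding linear_chart_def using mem onto inj lin by blast
  then show ?thesis by (auto simp: hom_dim_def)
qed

text \<open>Each entry of an intertwiner is \<open>1 / (z - w)\<close> times the difference of its lower and its left neighbour,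
  so the entries vanish one after another, starting from the bottom left corner.\<close>

lemma hom_dim_jordan_neq:
  assumes "z \<noteq> w"
  shows "hom_dim (block_pencil (JordanFin r z)) (block_pencil (JordanFin s w)) 0"
proof -
  have zero: "Y = 0\<^sub>m s r \<and> X = 0\<^sub>m s r"
    if YX: "(Y, X) \<in> pencil_hom (block_pencil (JordanFin r z)) (block_pencil (JordanFin s w))" for Y X
  proof -
    have "Y = X" and X: "X \<in> carrier_mat s r"
      and e: "\<And>i j. i < s \<Longrightarrow> j < r \<Longrightarrow> z * X $$ (i, j) + (if j = 0 then 0 else X $$ (i, j - 1)) =
      w * X $$ (i, j) + (if i + 1 < s then X $$ (i + 1, j) else 0)"
      using YX unfolding hom_jordan_iff by auto
    have "X $$ (i, j) = 0" if "i < s" "j < r" for i j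
      using that
    proof (induction "s - i + j" arbitrary: i j rule: less_induct)
      case less
      have "(if j = 0 then 0 else X $$ (i, j - 1)) = 0" using less.hyps[of i "j - 1"] less.prems by simp
      moreover have "(if i + 1 < s then X $$ (i + 1, j) else 0) = 0"
        using less.hyps[of "i + 1" j] less.prems by simp
      ultimately have "z * X $$ (i, j) = w * X $$ (i, j)" using e[of i j] less.prems by simp
      then show ?case using assms by simp
    qed
    then show ?thesis using X \<open>Y = X\<close> by (auto intro!: eq_matI)
  qed
  show ?thesis unfolding block_pencil.simps
  proof (rule hom_dim_0I)
    fix Y X assume "Y \<in> carrier_mat s r" "X \<in> carrier_mat s r"
      "Y * jordan_block r z = jordan_block s w * X" "Y * 1\<^sub>m r = 1\<^sub>m s * X"
    then show "Y = 0\<^sub>m s r \<and> X = 0\<^sub>m s r" by (intro zero) (simp add: pencil_hom_def)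
  qed simp_all
qed

lemma pencil_hom_swap: "(Y, X) \<in> pencil_hom (B, A) (B', A') \<longleftrightarrow> (Y, X) \<in> pencil_hom (A, B) (A', B')"
  if "dim_row A = dim_row B" "dim_col A = dim_col B" "dim_row A' = dim_row B'" "dim_col A' = dim_col B'"
  using that by (auto simp: pencil_hom_def)

lemma hom_dim_JordanInf_JordanInf:
  "hom_dim (block_pencil (JordanInf r)) (block_pencil (JordanInf s)) (min r s)"
proof -
  have "pencil_hom (block_pencil (JordanInf r)) (block_pencil (JordanInf s)) =
      pencil_hom (block_pencil (JordanFin r 0)) (block_pencil (JordanFin s 0))"
    by (auto simp: pencil_hom_swap[of "jordan_block r 0" "1\<^sub>m r" "jordan_block s 0" "1\<^sub>m s"])
  then show ?thesis using hom_dim_jordan_eq[of r 0 s] by (simp add: hom_dim_def)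
qed

text \<open>The equations combine to \<open>X = N X J\<close> with \<open>N\<close> nilpotent, which makes the rows of \<open>X\<close> vanish from the bottom
  upwards.\<close>

lemma hom_dim_JordanFin_JordanInf:
  "hom_dim (block_pencil (JordanFin r z)) (block_pencil (JordanInf s)) 0"
proof -
  have zero: "Y = 0\<^sub>m s r \<and> X = 0\<^sub>m s r"
    if Y: "Y \<in> carrier_mat s r" and X: "X \<in> carrier_mat s r"
      and e: "Y * jordan_block r z = 1\<^sub>m s * X" "Y * 1\<^sub>m r = jordan_block s 0 * X" for Y X
  proof -
    have Y_eq: "Y $$ (i, j) = (if i + 1 < s then X $$ (i + 1, j) else 0)" if "i < s" "j < r" for i j
      using jordan_block_mult[OF X that, of 0] e(2) Y by simp
    have X_eq: "X $$ (i, j) = z * Y $$ (i, j) + (if j = 0 then 0 else Y $$ (i, j - 1))" if "i < s" "j < r" for i j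
      using mult_jordan_block[OF Y that, of z] e(1) X by simp
    have X0: "X $$ (i, j) = 0" if "i < s" "j < r" for i j
      using that
    proof (induction "s - i" arbitrary: i j rule: less_induct)
      case less
      have "Y $$ (i, j') = 0" if "j' < r" for j'
        using Y_eq[of i j'] less.hyps[of "i + 1" j'] less.prems that by simp
      then show ?case using X_eq[of i j] less.prems by simp
    qed
    moreover have "Y $$ (i, j) = 0" if "i < s" "j < r" for i j
      using X0[of "i + 1" j] Y_eq[of i j] that by simp
    ultimately show ?thesis using X Y by (auto intro!: eq_matI)
  qed
  show ?thesis unfolding block_pencil.simps
    by (rule hom_dim_0I[where r = r and c = r and r' = s and c' = s]) (simp, simp, rule zero)
qed

text \<open>The equations combine to \<open>X = J X N\<close> with \<open>N\<close> nilpotent, which makes the columns of \<open>X\<close> vanish from left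
  to right.\<close>

lemma hom_dim_JordanInf_JordanFin:
  "hom_dim (block_pencil (JordanInf r)) (block_pencil (JordanFin s w)) 0"
proof -
  have zero: "Y = 0\<^sub>m s r \<and> X = 0\<^sub>m s r"
    if Y: "Y \<in> carrier_mat s r" and X: "X \<in> carrier_mat s r"
      and e: "Y * 1\<^sub>m r = jordan_block s w * X" "Y * jordan_block r 0 = 1\<^sub>m s * X" for Y X
  proof -
    have Y_eq: "Y $$ (i, j) = w * X $$ (i, j) + (if i + 1 < s then X $$ (i + 1, j) else 0)" if "i < s" "j < r" for i j
      using jordan_block_mult[OF X that, of w] e(1) Y by simp
    have X_eq: "X $$ (i, j) = (if j = 0 then 0 else Y $$ (i, j - 1))" if "i < s" "j < r" for i j
      using mult_jordan_block[OF Y that, of 0] e(2) X by simp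
    have X0: "X $$ (i, j) = 0" if "i < s" "j < r" for i j
      using that
    proof (induction j arbitrary: i)
      case 0 then show ?case using X_eq[of i 0] by simp
    next
      case (Suc j)
      then show ?case using X_eq[of i "Suc j"] Y_eq[of i j] Suc.IH[of i] Suc.IH[of "i + 1"] by simp
    qed
    moreover have "Y $$ (i, j) = 0" if "i < s" "j < r" for i j
      using X0[of "i + 1" j] X0[of i j] Y_eq[of i j] that by simp
    ultimately show ?thesis using X Y by (auto intro!: eq_matI)
  qed
  show ?thesis unfolding block_pencil.simps
    by (rule hom_dim_0I[where r = r and c = r and r' = s and c' = s]) (simp, simp, rule zero)
qed

section \<open>Morphisms between Kronecker structures\<close>

fun block_rows :: "kronecker_block \<Rightarrow> nat" where
  "block_rows (JordanFin r z) = r"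
| "block_rows (JordanInf r) = r"
| "block_rows (SingL r) = r"
| "block_rows (SingLT r) = r + 1"

fun block_cols :: "kronecker_block \<Rightarrow> nat" where
  "block_cols (JordanFin r z) = r"
| "block_cols (JordanInf r) = r"
| "block_cols (SingL r) = r + 1"
| "block_cols (SingLT r) = r"

lemma block_pencil_carrier: "block_pencil b \<in> pencil_carrier (block_rows b) (block_cols b)"
  using singular_pencil_in_carrier
  by (cases b) (simp_all add: block_SingLT del: block_pencil.simps(4))

text \<open>The table is not symmetric: between blocks of different type, morphisms run only in the order from
  \<open>L\<^sub>r\<^sup>T\<close> to regular blocks to \<open>L\<^sub>r\<close>, that is, from preprojective to regular to preinjective representations of
  the Kronecker quiver.\<close>

fun block_hom_dim :: "kronecker_block \<Rightarrow> kronecker_block \<Rightarrow> nat" where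
  "block_hom_dim (JordanFin r z) (JordanFin s w) = (if z = w then min r s else 0)"
| "block_hom_dim (JordanInf r) (JordanInf s) = min r s"
| "block_hom_dim (JordanFin r z) (JordanInf s) = 0"
| "block_hom_dim (JordanInf r) (JordanFin s w) = 0"
| "block_hom_dim (SingL r) (SingL s) = r + 1 - s"
| "block_hom_dim (SingLT r) (SingLT s) = s + 1 - r"
| "block_hom_dim (SingLT r) (SingL s) = r + s"
| "block_hom_dim (SingL r) (SingLT s) = 0"
| "block_hom_dim (SingLT r) (JordanFin s w) = s"
| "block_hom_dim (SingLT r) (JordanInf s) = s"
| "block_hom_dim (JordanFin r z) (SingL s) = r"
| "block_hom_dim (JordanInf r) (SingL s) = r"
| "block_hom_dim (SingL r) (JordanFin s w) = 0"
| "block_hom_dim (SingL r) (JordanInf s) = 0"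
| "block_hom_dim (JordanFin r z) (SingLT s) = 0"
| "block_hom_dim (JordanInf r) (SingLT s) = 0"

text \<open>The target \<open>L\<^sub>s\<^sup>T\<close> has injective components: \<open>L\<^sub>s\<close> itself supplies the left inverses.\<close>

lemma hom_dim_SingL_SingLT: "hom_dim (block_pencil (SingL r)) (block_pencil (SingLT s)) 0"
proof -
  let ?B = "snd (singular_pencil s)"
  have "?B * transpose_mat ?B = 1\<^sub>m s"
    using singular_pencil_carrier(2)[of s]
    by (subst singular_snd_mult[of _ s s]) (auto simp: singular_pencil_def intro!: eq_matI)
  then show ?thesis
    unfolding block_pencil.simps(4)
    using singular_pencil_carrier[of s]
    by (intro hom_dim_SingL_left_invertible_snd[where C = ?B and p = "s + 1" and q = s]) auto
qed

text \<open>Transposing these pencils exchanges source and target and turns \<open>L\<^sub>s\<close> into \<open>L\<^sub>s\<^sup>T\<close>, which leads back to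
  morphisms from a singular block into a regular one.\<close>

lemma hom_dim_regular_singular:
  assumes A: "A \<in> carrier_mat N N"
  shows "hom_dim (A, 1\<^sub>m N) (block_pencil (SingL s)) N"
    and "hom_dim (1\<^sub>m N, A) (block_pencil (SingL s)) N"
    and "hom_dim (A, 1\<^sub>m N) (block_pencil (SingLT s)) 0"
    and "hom_dim (1\<^sub>m N, A) (block_pencil (SingLT s)) 0"
proof -
  have AT: "transpose_mat A \<in> carrier_mat N N" using A by simp
  have T: "transpose_pencil (block_pencil (SingLT s)) = block_pencil (SingL s)"
    "transpose_pencil (block_pencil (SingL s)) = block_pencil (SingLT s)"
    by (simp_all add: block_SingLT del: block_pencil.simps(4))
  have TA: "transpose_pencil (transpose_mat A, 1\<^sub>m N) = (A, 1\<^sub>m N)"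
    "transpose_pencil (1\<^sub>m N, transpose_mat A) = (1\<^sub>m N, A)"
    by (simp_all add: transpose_pencil_def)
  have c: "(transpose_mat A, 1\<^sub>m N) \<in> pencil_carrier N N" "(1\<^sub>m N, transpose_mat A) \<in> pencil_carrier N N"
    using A by simp_all
  show "hom_dim (A, 1\<^sub>m N) (block_pencil (SingL s)) N"
    using hom_dim_transpose[OF block_pencil_carrier c(1) hom_dim_SingLT_fst[OF AT, of s]] by (simp add: T TA del: block_pencil.simps)
  show "hom_dim (1\<^sub>m N, A) (block_pencil (SingL s)) N"
    using hom_dim_transpose[OF block_pencil_carrier c(2) hom_dim_SingLT_snd[OF AT, of s]] by (simp add: T TA del: block_pencil.simps)
  have "hom_dim (block_pencil (SingL s)) (transpose_mat A, 1\<^sub>m N) 0"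
    by (rule hom_dim_SingL_left_invertible_snd[OF AT one_carrier_mat one_carrier_mat]) simp
  from hom_dim_transpose[OF block_pencil_carrier c(1) this]
  show "hom_dim (A, 1\<^sub>m N) (block_pencil (SingLT s)) 0" by (simp add: T TA del: block_pencil.simps)
  have "hom_dim (block_pencil (SingL s)) (1\<^sub>m N, transpose_mat A) 0"
    by (rule hom_dim_SingL_left_invertible_fst[OF one_carrier_mat AT one_carrier_mat]) simp
  from hom_dim_transpose[OF block_pencil_carrier c(2) this]
  show "hom_dim (1\<^sub>m N, A) (block_pencil (SingLT s)) 0" by (simp add: T TA del: block_pencil.simps)
qed

lemma hom_dim_SingLT_SingLT: "hom_dim (block_pencil (SingLT r)) (block_pencil (SingLT s)) (s + 1 - r)"
  using hom_dim_transpose[OF block_pencil_carrier block_pencil_carrier hom_dim_SingL_SingL[of s r]]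
  by (simp add: block_SingLT del: block_pencil.simps(4))

lemma hom_dim_block: "hom_dim (block_pencil b) (block_pencil b') (block_hom_dim b b')"
proof -
  have J: "jordan_block k w \<in> carrier_mat k k" for k and w :: complex by simp
  have Fin: "block_pencil (JordanFin k w) = (jordan_block k w, 1\<^sub>m k)"
    and Inf: "block_pencil (JordanInf k) = (1\<^sub>m k, jordan_block k 0)" for k w by simp_all
  note rs = hom_dim_regular_singular[OF J]
  have L: "hom_dim (block_pencil (SingL r)) (block_pencil (JordanFin k w)) 0"
    "hom_dim (block_pencil (SingL r)) (block_pencil (JordanInf k)) 0" for r k w
    unfolding Fin Inf
    by (rule hom_dim_SingL_left_invertible_snd[OF J one_carrier_mat one_carrier_mat], simp)
      (rule hom_dim_SingL_left_invertible_fst[OF one_carrier_mat J one_carrier_mat], simp)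
  have LT: "hom_dim (block_pencil (SingLT r)) (block_pencil (JordanFin k w)) k"
    "hom_dim (block_pencil (SingLT r)) (block_pencil (JordanInf k)) k" for r k w
    unfolding Fin Inf by (rule hom_dim_SingLT_fst[OF J], rule hom_dim_SingLT_snd[OF J])
  have FF: "hom_dim (block_pencil (JordanFin r z)) (block_pencil (JordanFin s w)) (if z = w then min r s else 0)"
    for r s z w using hom_dim_jordan_eq[of r z s] hom_dim_jordan_neq[of z w r s] by (cases "z = w") simp_all
  note all = L LT FF hom_dim_JordanInf_JordanInf hom_dim_JordanFin_JordanInf hom_dim_JordanInf_JordanFin
    hom_dim_SingL_SingL hom_dim_SingLT_SingLT hom_dim_SingLT_SingL hom_dim_SingL_SingLT
    rs[folded Fin] rs(2,4)[of _ 0, folded Inf]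
  show ?thesis
    by (cases b; cases b'; simp only: block_hom_dim.simps; rule all)
qed

lemma direct_sum_pencil_Nil: "direct_sum_pencil [] = (0\<^sub>m 0 0, 0\<^sub>m 0 0)"
  by (simp add: direct_sum_pencil_def)

lemma direct_sum_pencil_Cons:
  "direct_sum_pencil (K # Ks) =
    (dsum (fst K) (fst (direct_sum_pencil Ks)), dsum (snd K) (snd (direct_sum_pencil Ks)))"
  by (simp add: direct_sum_pencil_def dsum_def Let_def)

lemma pencil_carrier_fst_snd:
  "K \<in> pencil_carrier r c \<longleftrightarrow> fst K \<in> carrier_mat r c \<and> snd K \<in> carrier_mat r c"
  by (cases K) simp

lemma direct_sum_pencil_carrier:
  assumes "\<And>x. x \<in> set xs \<Longrightarrow> g x \<in> pencil_carrier (\<rho> x) (\<gamma> x)"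
  shows "direct_sum_pencil (map g xs) \<in> pencil_carrier (\<Sum>x\<leftarrow>xs. \<rho> x) (\<Sum>x\<leftarrow>xs. \<gamma> x)"
  using assms
proof (induction xs)
  case Nil then show ?case by (simp add: direct_sum_pencil_Nil)
next
  case (Cons x xs)
  have "direct_sum_pencil (map g xs) \<in> pencil_carrier (\<Sum>x\<leftarrow>xs. \<rho> x) (\<Sum>x\<leftarrow>xs. \<gamma> x)"
    "g x \<in> pencil_carrier (\<rho> x) (\<gamma> x)" using Cons by auto
  then show ?case by (simp add: direct_sum_pencil_Cons pencil_carrier_fst_snd)
qed

lemma hom_dim_direct_sum_left:
  assumes g: "\<And>x. x \<in> set xs \<Longrightarrow> g x \<in> pencil_carrier (\<rho> x) (\<gamma> x)"
    and K': "K' \<in> pencil_carrier r' c'"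
    and f: "\<And>x. x \<in> set xs \<Longrightarrow> hom_dim (g x) K' (f x)"
  shows "hom_dim (direct_sum_pencil (map g xs)) K' (\<Sum>x\<leftarrow>xs. f x)"
  using g f
proof (induction xs)
  case Nil
  obtain A B where AB: "K' = (A, B)" by force
  have "hom_dim (0\<^sub>m 0 0, 0\<^sub>m 0 0) (A, B) 0"
    by (rule hom_dim_0I[of _ _ 0 0 _ _ r' c']) (use K' AB in \<open>auto intro!: eq_matI\<close>)
  then show ?case by (simp add: direct_sum_pencil_Nil AB)
next
  case (Cons x xs)
  obtain A B where AB: "K' = (A, B)" by force
  have 1: "g x \<in> pencil_carrier (\<rho> x) (\<gamma> x)" "hom_dim (g x) K' (f x)" using Cons.prems by auto
  have 2: "direct_sum_pencil (map g xs) \<in> pencil_carrier (\<Sum>x\<leftarrow>xs. \<rho> x) (\<Sum>x\<leftarrow>xs. \<gamma> x)"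
    using Cons.prems by (intro direct_sum_pencil_carrier) auto
  have 3: "hom_dim (direct_sum_pencil (map g xs)) K' (\<Sum>x\<leftarrow>xs. f x)"
    using Cons by simp
  show ?case
    unfolding list.map direct_sum_pencil_Cons sum_list.Cons AB
    by (rule hom_dim_dsum_left) (use 1 2 3 K' in \<open>auto simp: AB pencil_carrier_fst_snd\<close>)
qed

lemma transpose_direct_sum_pencil:
  assumes "\<And>x. x \<in> set xs \<Longrightarrow> g x \<in> pencil_carrier (\<rho> x) (\<gamma> x)"
  shows "transpose_pencil (direct_sum_pencil (map g xs)) = direct_sum_pencil (map (\<lambda>x. transpose_pencil (g x)) xs)"
  using assms
proof (induction xs)
  case Nil then show ?case by (simp add: direct_sum_pencil_Nil transpose_pencil_def)
next
  case (Cons x xs)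
  have T: "transpose_mat (dsum A B) = dsum (transpose_mat A) (transpose_mat B)" for A B
    unfolding dsum_def by (subst transpose_four_block_mat) auto
  have "transpose_pencil (direct_sum_pencil (map g xs)) = direct_sum_pencil (map (\<lambda>x. transpose_pencil (g x)) xs)"
    using Cons by simp
  then show ?case
    by (simp add: direct_sum_pencil_Cons transpose_pencil_def T prod_eq_iff)
qed

lemma hom_dim_direct_sum_right:
  assumes g: "\<And>x. x \<in> set xs \<Longrightarrow> g x \<in> pencil_carrier (\<rho> x) (\<gamma> x)"
    and K: "K \<in> pencil_carrier r c"
    and f: "\<And>x. x \<in> set xs \<Longrightarrow> hom_dim K (g x) (f x)"
  shows "hom_dim K (direct_sum_pencil (map g xs)) (\<Sum>x\<leftarrow>xs. f x)"
proof -
  have "hom_dim (direct_sum_pencil (map (\<lambda>x. transpose_pencil (g x)) xs)) (transpose_pencil K) (\<Sum>x\<leftarrow>xs. f x)"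
  proof (rule hom_dim_direct_sum_left)
    show "transpose_pencil (g x) \<in> pencil_carrier (\<gamma> x) (\<rho> x)" if "x \<in> set xs" for x using g[OF that] by simp
    show "transpose_pencil K \<in> pencil_carrier c r" using K by simp
    show "hom_dim (transpose_pencil (g x)) (transpose_pencil K) (f x)" if "x \<in> set xs" for x
      by (rule hom_dim_transpose[OF K g[OF that] f[OF that]])
  qed
  then have T: "hom_dim (transpose_pencil (direct_sum_pencil (map g xs))) (transpose_pencil K) (\<Sum>x\<leftarrow>xs. f x)"
    by (simp add: transpose_direct_sum_pencil[OF g])
  have c: "transpose_pencil (direct_sum_pencil (map g xs)) \<in> pencil_carrier (\<Sum>x\<leftarrow>xs. \<gamma> x) (\<Sum>x\<leftarrow>xs. \<rho> x)"
    "transpose_pencil K \<in> pencil_carrier c r"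
    using direct_sum_pencil_carrier[of xs g \<rho> \<gamma>] g K by simp_all
  show ?thesis using hom_dim_transpose[OF c T] by simp
qed

text \<open>Indexed by multisets, the double sum is biadditive, so the paired blocks of a structure can be
  treated as units.\<close>

definition hom_sum :: "kronecker_block multiset \<Rightarrow> kronecker_block multiset \<Rightarrow> nat" where
  "hom_sum M N = (\<Sum>b\<in>#M. \<Sum>b'\<in>#N. block_hom_dim b b')"

text \<open>Additivity in both arguments reduces the endomorphisms to morphisms between single blocks. The number
  of rows is recorded as well, because it expresses the size of the regular part by \<open>n\<close>.\<close>

lemma kronecker_structure_hom_dim:
  assumes "has_kronecker_structure (A, B) M" and A: "A \<in> carrier_mat n n" "B \<in> carrier_mat n n"
  shows "hom_dim (A, B) (A, B) (hom_sum M M)" and "n = (\<Sum>b\<in>#M. block_rows b)"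
proof -
  obtain bs where bs: "mset bs = M"
    and eq: "strictly_equivalent (A, B) (direct_sum_pencil (map block_pencil bs))"
    using assms by (auto simp: has_kronecker_structure_def)
  let ?D = "direct_sum_pencil (map block_pencil bs)"
  have D: "?D \<in> pencil_carrier (\<Sum>b\<leftarrow>bs. block_rows b) (\<Sum>b\<leftarrow>bs. block_cols b)"
    by (rule direct_sum_pencil_carrier[OF block_pencil_carrier])
  have "hom_dim ?D ?D (\<Sum>b\<leftarrow>bs. \<Sum>b'\<leftarrow>bs. block_hom_dim b b')"
    by (intro hom_dim_direct_sum_left[OF block_pencil_carrier D]
        hom_dim_direct_sum_right[OF block_pencil_carrier block_pencil_carrier] hom_dim_block)
  moreover have "(\<Sum>b\<leftarrow>bs. \<Sum>b'\<leftarrow>bs. block_hom_dim b b') = hom_sum M M"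
    by (simp add: hom_sum_def bs[symmetric] flip: mset_map sum_mset_sum_list)
  ultimately show "hom_dim (A, B) (A, B) (hom_sum M M)"
    using hom_dim_strictly_equivalent[OF eq] by simp
  have "dim_row (fst ?D) = n" using eq A by (auto simp: strictly_equivalent_def)
  moreover have "dim_row (fst ?D) = (\<Sum>b\<leftarrow>bs. block_rows b)"
    using D by (auto simp: pencil_carrier_fst_snd)
  ultimately show "n = (\<Sum>b\<in>#M. block_rows b)"
    by (simp add: bs[symmetric] flip: mset_map sum_mset_sum_list)
qed

section \<open>Solutions as a real form of the endomorphism space\<close>

lemma mat_adjoint_dim [simp]:
  "dim_row (mat_adjoint A) = dim_col A" "dim_col (mat_adjoint A) = dim_row A"
  using mat_adjoint_carrier[of A "dim_row A" "dim_col A"] by auto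

lemma mat_adjoint_entry [simp]:
  "i < dim_col A \<Longrightarrow> j < dim_row A \<Longrightarrow> mat_adjoint A $$ (i, j) = cnj (A $$ (j, i))"
  by (simp add: mat_adjoint_index conjugate_complex_def)

lemma mat_adjoint_adjoint [simp]: "mat_adjoint (mat_adjoint A) = (A :: complex mat)"
  by (rule eq_matI) auto

lemma mat_adjoint_add:
  "U \<in> carrier_mat r c \<Longrightarrow> V \<in> carrier_mat r c \<Longrightarrow>
    mat_adjoint (U + V) = mat_adjoint U + mat_adjoint (V :: complex mat)"
  by (intro eq_matI) auto

lemma one_smult_mat [simp]: "1 \<cdot>\<^sub>m A = (A :: complex mat)"
  by (rule eq_matI) auto

lemma mat_adjoint_mult:
  fixes A B :: "complex mat"
  assumes "A \<in> carrier_mat p q" "B \<in> carrier_mat q r"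
  shows "mat_adjoint (A * B) = mat_adjoint B * mat_adjoint A"
  using assms by (intro eq_matI) (auto simp: scalar_prod_def intro!: sum.cong)

text \<open>The map \<open>T\<close> projects an endomorphism \<open>(Y, X)\<close> to the solution \<open>(X - Y\<^sup>H) / 2\<close>, its part fixed by the involution.
  It is onto, and its kernel consists of the anti-fixed endomorphisms, which are \<open>\<i>\<close> times the fixed ones
  and hence again a copy of the solution space. As the endomorphism space has real dimension \<open>2 d\<close>, the
  rank-nullity theorem counts the solution space twice.\<close>

lemma solution_space_dim:
  assumes J: "J \<in> carrier_mat n n" and d: "hom_dim (J, mat_adjoint J) (J, mat_adjoint J) d"
  shows "vectorspace.fin_dim class_ring (solution_space n J)"
    and "vectorspace.dim class_ring (solution_space n J) = d"
proof -
  note adj = mat_adjoint_carrier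
  let ?H = "pencil_hom (J, mat_adjoint J) (J, mat_adjoint J)"
  let ?S = "solution_space n J" and ?V = "module_vec TYPE(real) (2 * d)"
  obtain \<Psi> where \<Psi>: "linear_chart \<Psi> d ?H" using d by (auto simp: hom_dim_def)
  note chart = linear_chartD[OF \<Psi>]
  have H: "(Y, X) \<in> ?H \<longleftrightarrow> Y \<in> carrier_mat n n \<and> X \<in> carrier_mat n n \<and>
      Y * J = J * X \<and> Y * mat_adjoint J = mat_adjoint J * X" for Y X
    by (rule pencil_hom_iff) (use J adj[OF J] in simp_all)
  have H_lin: "pair_lincomb a u v \<in> ?H" if uv: "u \<in> ?H" "v \<in> ?H" for a u v
  proof -
    obtain g h where "\<Psi> g = u" "\<Psi> h = v" using chart(1) uv by meson
    then have "pair_lincomb a u v = \<Psi> (\<lambda>k. a * g k + h k)" by (simp add: chart(4))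
    then show ?thesis by (simp add: chart(2))
  qed
  have H_flip: "(mat_adjoint X, mat_adjoint Y) \<in> ?H" if "(Y, X) \<in> ?H" for Y X
  proof -
    have c: "Y \<in> carrier_mat n n" "X \<in> carrier_mat n n"
      and e: "Y * J = J * X" "Y * mat_adjoint J = mat_adjoint J * X" using that by (auto simp: H)
    have "mat_adjoint X * mat_adjoint J = mat_adjoint J * mat_adjoint Y"
      using arg_cong[OF e(1), of mat_adjoint] c J by (simp add: mat_adjoint_mult[of _ n n _ n])
    moreover have "mat_adjoint X * J = J * mat_adjoint Y"
      using arg_cong[OF e(2), of mat_adjoint] c J adj[OF J] by (simp add: mat_adjoint_mult[of _ n n _ n])
    ultimately show ?thesis using c by (simp add: H adj)
  qed
  \<comment> \<open>The second equation of the endomorphism is the conjugate transpose of the first.\<close>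
  have sol: "Z \<in> carrier ?S \<longleftrightarrow> Z \<in> carrier_mat n n \<and> (- mat_adjoint Z, Z) \<in> ?H" for Z
  proof -
    have "mat_adjoint Z * J + J * Z = 0\<^sub>m n n \<longleftrightarrow> (- mat_adjoint Z, Z) \<in> ?H"
      if Z: "Z \<in> carrier_mat n n"
    proof
      assume e: "mat_adjoint Z * J + J * Z = 0\<^sub>m n n"
      have swap: "- P = Q" if "P + Q = 0\<^sub>m n n" "P \<in> carrier_mat n n" "Q \<in> carrier_mat n n"
        for P Q :: "complex mat"
      proof (rule eq_matI)
        fix i j assume "i < dim_row Q" "j < dim_col Q"
        then show "(- P) $$ (i, j) = Q $$ (i, j)"
          using that(2,3) arg_cong[OF that(1), of "\<lambda>M. M $$ (i, j)"] by (simp add: add_eq_0_iff)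
      qed (use that in auto)
      have eA: "- (mat_adjoint Z * J) = J * Z"
        using e Z J adj[OF Z] by (intro swap) auto
      have "mat_adjoint J * Z + mat_adjoint Z * mat_adjoint J = mat_adjoint (mat_adjoint Z * J + J * Z)"
        using Z J adj[OF Z] mat_adjoint_add[of "mat_adjoint Z * J" n n "J * Z"]
        by (simp add: mat_adjoint_mult[of _ n n _ n])
      also have "\<dots> = 0\<^sub>m n n" unfolding e by (intro eq_matI) auto
      finally have "mat_adjoint Z * mat_adjoint J + mat_adjoint J * Z = 0\<^sub>m n n"
        using comm_add_mat[of "mat_adjoint J * Z" n n "mat_adjoint Z * mat_adjoint J"] Z J adj[OF Z] adj[OF J]
        by simp
      then have eB: "- (mat_adjoint Z * mat_adjoint J) = mat_adjoint J * Z"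
        using Z J adj[OF Z] adj[OF J] by (intro swap) auto
      show "(- mat_adjoint Z, Z) \<in> ?H"
        unfolding H using Z J eA eB adj[OF Z] adj[OF J] by simp
    next
      assume "(- mat_adjoint Z, Z) \<in> ?H"
      then have "J * Z = - (mat_adjoint Z * J)" using Z J adj[OF Z] by (simp add: H)
      then show "mat_adjoint Z * J + J * Z = 0\<^sub>m n n"
        using Z J by (auto intro!: eq_matI simp del: index_mult_mat(1))
    qed
    then show ?thesis by (auto simp: solution_space_def solution_set_def real_module_mat_def)
  qed
  \<comment> \<open>The chart over the reals: the first \<open>d\<close> coordinates are real parts, the last \<open>d\<close> imaginary parts.\<close>
  define \<Phi> where "\<Phi> v = \<Psi> (\<lambda>k. Complex (v $ k) (v $ (d + k)))" for v
  have \<Phi>_mem: "\<Phi> v \<in> ?H" for v unfolding \<Phi>_def by (rule chart(2))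
  have \<Phi>_lin: "\<Phi> (c \<cdot>\<^sub>v v + w) = pair_lincomb (complex_of_real c) (\<Phi> v) (\<Phi> w)"
    if "v \<in> carrier_vec (2 * d)" "w \<in> carrier_vec (2 * d)" for c v w
  proof -
    have "\<Phi> (c \<cdot>\<^sub>v v + w) = \<Psi> (\<lambda>k. complex_of_real c * Complex (v $ k) (v $ (d + k)) + Complex (w $ k) (w $ (d + k)))"
      unfolding \<Phi>_def chart(3) using that by (simp add: complex_eq_iff)
    then show ?thesis by (simp add: chart(4) \<Phi>_def)
  qed
  have \<Phi>_inj: "v = w" if "\<Phi> v = \<Phi> w" "v \<in> carrier_vec (2 * d)" "w \<in> carrier_vec (2 * d)" for v w
  proof (rule eq_vecI)
    have e: "v $ k = w $ k \<and> v $ (d + k) = w $ (d + k)" if "k < d" for k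
      using \<open>\<Phi> v = \<Phi> w\<close> that unfolding \<Phi>_def chart(3) by simp
    fix i assume "i < dim_vec w"
    then show "v $ i = w $ i" using e[of i] e[of "i - d"] that by (cases "i < d") auto
  qed (use that in auto)
  have \<Phi>_surj: "\<exists>v\<in>carrier_vec (2 * d). \<Phi> v = u" if u: "u \<in> ?H" for u
  proof -
    obtain h where h: "\<Psi> h = u" using chart(1) u by blast
    let ?v = "vec (2 * d) (\<lambda>i. if i < d then Re (h i) else Im (h (i - d)))"
    have "\<Phi> ?v = u" unfolding \<Phi>_def h[symmetric] chart(3) by (simp add: complex_eq_iff)
    then show ?thesis by (intro bexI[of _ ?v]) auto
  qed
  have \<Phi>_carrier: "fst (\<Phi> v) \<in> carrier_mat n n" "snd (\<Phi> v) \<in> carrier_mat n n" for v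
    using \<Phi>_mem[of v] by (cases "\<Phi> v"; simp add: H)+
  define T where "T v = (1/2 :: complex) \<cdot>\<^sub>m (snd (\<Phi> v) + (-1) \<cdot>\<^sub>m mat_adjoint (fst (\<Phi> v)))" for v
  have T_carrier: "T v \<in> carrier_mat n n" for v
    using \<Phi>_carrier[of v] by (simp add: T_def adj)
  have T_mem: "T v \<in> carrier ?S" for v
  proof -
    obtain Y X where YX: "\<Phi> v = (Y, X)" by force
    then have u: "(Y, X) \<in> ?H" using \<Phi>_mem[of v] by simp
    have "pair_lincomb (1/2) (pair_lincomb (-1) (mat_adjoint X, mat_adjoint Y) (Y, X)) (pair_lincomb (-1) (Y, X) (Y, X)) \<in> ?H"
      using u H_flip[OF u] by (intro H_lin)
    moreover have "pair_lincomb (1/2) (pair_lincomb (-1) (mat_adjoint X, mat_adjoint Y) (Y, X)) (pair_lincomb (-1) (Y, X) (Y, X))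
        = (- mat_adjoint (T v), T v)"
    proof -
      have "Y \<in> carrier_mat n n" "X \<in> carrier_mat n n" using u by (simp_all add: H)
      then show ?thesis by (auto simp: pair_lincomb_def T_def YX field_simps intro!: eq_matI)
    qed
    ultimately show ?thesis by (simp add: sol T_carrier)
  qed
  interpret V: vectorspace "class_ring :: real ring" ?V by (rule vec_vs)
  interpret S: vectorspace "class_ring :: real ring" ?S by (rule vectorspace_solution_space[OF J])
  have S_simps: "\<And>x y. x \<oplus>\<^bsub>?S\<^esub> y = x + y" "\<And>c x. c \<odot>\<^bsub>?S\<^esub> x = complex_of_real c \<cdot>\<^sub>m x" "\<zero>\<^bsub>?S\<^esub> = 0\<^sub>m n n"
    by (simp_all add: solution_space_def real_module_mat_def)
  \<comment> \<open>Zero as a combination with coefficient \<open>-1\<close>, so that the linearity of \<open>\<Phi>\<close> and \<open>T\<close> sends it to zero.\<close>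
  have zero_split: "0\<^sub>v (2 * d) = (-1) \<cdot>\<^sub>v 0\<^sub>v (2 * d) + (0\<^sub>v (2 * d) :: real vec)"
    by (intro eq_vecI) auto
  have T_lin: "T (c \<cdot>\<^sub>v v + w) = complex_of_real c \<cdot>\<^sub>m T v + T w"
    if "v \<in> carrier_vec (2 * d)" "w \<in> carrier_vec (2 * d)" for c v w
    using \<Phi>_carrier[of v] \<Phi>_carrier[of w] unfolding T_def \<Phi>_lin[OF that]
    by (auto simp: pair_lincomb_def algebra_simps intro!: eq_matI)
  have T_hom: "T \<in> module_hom class_ring ?V ?S"
  proof -
    have "T (v + w) = T v + T w" if "v \<in> carrier_vec (2 * d)" "w \<in> carrier_vec (2 * d)" for v w
      using T_lin[OF that, of 1] by simp
    moreover have "T (c \<cdot>\<^sub>v v) = complex_of_real c \<cdot>\<^sub>m T v" if v: "v \<in> carrier_vec (2 * d)" for c v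
    proof -
      have "T (0\<^sub>v (2 * d)) = T ((-1) \<cdot>\<^sub>v 0\<^sub>v (2 * d) + 0\<^sub>v (2 * d))"
        using zero_split by simp
      also have "\<dots> = (-1) \<cdot>\<^sub>m T (0\<^sub>v (2 * d)) + T (0\<^sub>v (2 * d))" by (subst T_lin) auto
      also have "\<dots> = 0\<^sub>m n n" using T_carrier[of "0\<^sub>v (2 * d)"] by (auto intro!: eq_matI)
      finally have "T (0\<^sub>v (2 * d)) = 0\<^sub>m n n" .
      then show ?thesis using T_lin[OF v, of "0\<^sub>v (2 * d)" c] v T_carrier by simp
    qed
    ultimately show ?thesis
      using T_mem by (auto simp: module_hom_def module_vec_simps S_simps)
  qed
  interpret T: linear_map "class_ring :: real ring" ?V ?S T
    by (unfold_locales) (rule T_hom)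
  have surj: "T ` carrier ?V = carrier ?S"
  proof
    show "T ` carrier ?V \<subseteq> carrier ?S" using T_mem by auto
    show "carrier ?S \<subseteq> T ` carrier ?V"
    proof
      fix Z assume Z: "Z \<in> carrier ?S"
      then have c: "Z \<in> carrier_mat n n" and m: "(- mat_adjoint Z, Z) \<in> ?H" by (auto simp: sol)
      obtain v where v: "v \<in> carrier_vec (2 * d)" "\<Phi> v = (- mat_adjoint Z, Z)" using \<Phi>_surj[OF m] by auto
      have "T v = Z" using c by (auto simp: T_def v(2) intro!: eq_matI)
      then show "Z \<in> T ` carrier ?V" using v(1) by (auto simp: module_vec_simps)
    qed
  qed
  have fdV: "V.fin_dim" and dV: "V.dim = 2 * d"
    by (rule vec_space.fin_dim, rule vec_space.dim_is_n)
  show fdS: "S.fin_dim" by (rule T.surj_fin_dim[OF fdV surj])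
  have ker: "v \<in> T.kerT \<longleftrightarrow> v \<in> carrier_vec (2 * d) \<and> fst (\<Phi> v) = mat_adjoint (snd (\<Phi> v))" for v
  proof -
    have "T v = 0\<^sub>m n n \<longleftrightarrow> fst (\<Phi> v) = mat_adjoint (snd (\<Phi> v))"
    proof
      assume e: "T v = 0\<^sub>m n n"
      show "fst (\<Phi> v) = mat_adjoint (snd (\<Phi> v))"
      proof (rule eq_matI)
        fix i j assume "i < dim_row (mat_adjoint (snd (\<Phi> v)))" "j < dim_col (mat_adjoint (snd (\<Phi> v)))"
        then have ij: "i < n" "j < n" using \<Phi>_carrier(2)[of v] by auto
        have "T v $$ (j, i) = 0" using e ij by simp
        then have "snd (\<Phi> v) $$ (j, i) = cnj (fst (\<Phi> v) $$ (i, j))"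
          using ij \<Phi>_carrier[of v] by (simp add: T_def)
        then show "fst (\<Phi> v) $$ (i, j) = mat_adjoint (snd (\<Phi> v)) $$ (i, j)"
          using ij \<Phi>_carrier[of v] by simp
      qed (use \<Phi>_carrier[of v] in auto)
    next
      assume "fst (\<Phi> v) = mat_adjoint (snd (\<Phi> v))"
      then show "T v = 0\<^sub>m n n"
        using \<Phi>_carrier[of v] by (auto simp: T_def intro!: eq_matI)
    qed
    then show ?thesis by (auto simp: T.mod_hom.ker_def module_vec_simps S_simps)
  qed
  \<comment> \<open>\<open>R\<close> gives the coordinates of \<open>-\<i>\<close> times the endomorphism that belongs to the solution \<open>Z\<close>.\<close>
  define R where "R Z = (THE v. v \<in> carrier_vec (2 * d) \<and> \<Phi> v = pair_lincomb (- \<i>) (- mat_adjoint Z, Z) (0\<^sub>m n n, 0\<^sub>m n n))" for Z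
  have zero_mem: "(0\<^sub>m n n, 0\<^sub>m n n) \<in> ?H" using J adj[OF J] by (simp add: H)
  have R: "R Z \<in> carrier_vec (2 * d)" "\<Phi> (R Z) = pair_lincomb (- \<i>) (- mat_adjoint Z, Z) (0\<^sub>m n n, 0\<^sub>m n n)"
    if Z: "Z \<in> carrier ?S" for Z
  proof -
    have m: "pair_lincomb (- \<i>) (- mat_adjoint Z, Z) (0\<^sub>m n n, 0\<^sub>m n n) \<in> ?H"
      using Z zero_mem by (intro H_lin) (auto simp: sol)
    have "\<exists>!v. v \<in> carrier_vec (2 * d) \<and> \<Phi> v = pair_lincomb (- \<i>) (- mat_adjoint Z, Z) (0\<^sub>m n n, 0\<^sub>m n n)"
    proof (rule ex_ex1I)
      show "\<exists>v. v \<in> carrier_vec (2 * d) \<and> \<Phi> v = pair_lincomb (- \<i>) (- mat_adjoint Z, Z) (0\<^sub>m n n, 0\<^sub>m n n)"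
        using \<Phi>_surj[OF m] by blast
    qed (rule \<Phi>_inj, simp_all)
    from theI'[OF this] show "R Z \<in> carrier_vec (2 * d)" "\<Phi> (R Z) = pair_lincomb (- \<i>) (- mat_adjoint Z, Z) (0\<^sub>m n n, 0\<^sub>m n n)"
      by (auto simp: R_def)
  qed
  have R_ker: "R Z \<in> T.kerT" if Z: "Z \<in> carrier ?S" for Z
    using R[OF Z] Z by (auto simp: ker sol pair_lincomb_def intro!: eq_matI)
  let ?K = "?V\<lparr>carrier := T.kerT\<rparr>"
  interpret K: vectorspace "class_ring :: real ring" ?K
    by (rule V.subspace_is_vs[OF T.kerT_is_subspace])
  have R_lin: "R (complex_of_real c \<cdot>\<^sub>m Z + Z') = c \<cdot>\<^sub>v R Z + R Z'"
    if Z: "Z \<in> carrier ?S" and Z': "Z' \<in> carrier ?S" for c Z Z'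
  proof (rule \<Phi>_inj)
    have cZ: "complex_of_real c \<cdot>\<^sub>m Z \<in> carrier ?S" using S.smult_closed[of c Z] Z by (simp add: S_simps class_ring_simps)
    have m: "complex_of_real c \<cdot>\<^sub>m Z + Z' \<in> carrier ?S"
      using S.M.a_closed[OF cZ Z'] by (simp add: S_simps)
    show "R (complex_of_real c \<cdot>\<^sub>m Z + Z') \<in> carrier_vec (2 * d)" by (rule R(1)[OF m])
    show "c \<cdot>\<^sub>v R Z + R Z' \<in> carrier_vec (2 * d)" using R(1)[OF Z] R(1)[OF Z'] by simp
    show "\<Phi> (R (complex_of_real c \<cdot>\<^sub>m Z + Z')) = \<Phi> (c \<cdot>\<^sub>v R Z + R Z')"
      unfolding \<Phi>_lin[OF R(1)[OF Z] R(1)[OF Z']] R(2)[OF Z] R(2)[OF Z'] R(2)[OF m]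
      using Z Z' by (auto simp: sol pair_lincomb_def algebra_simps intro!: eq_matI)
  qed
  have R_hom: "R \<in> module_hom class_ring ?S ?K"
  proof -
    have zero: "R (0\<^sub>m n n) = 0\<^sub>v (2 * d)"
    proof (rule \<Phi>_inj)
      have z: "0\<^sub>m n n \<in> carrier ?S" using S.M.zero_closed by (simp add: S_simps)
      show "R (0\<^sub>m n n) \<in> carrier_vec (2 * d)" by (rule R(1)[OF z])
      have "\<Phi> (0\<^sub>v (2 * d)) = \<Phi> ((-1) \<cdot>\<^sub>v 0\<^sub>v (2 * d) + 0\<^sub>v (2 * d))"
        using zero_split by simp
      also have "\<dots> = pair_lincomb (-1) (\<Phi> (0\<^sub>v (2 * d))) (\<Phi> (0\<^sub>v (2 * d)))"
        by (subst \<Phi>_lin) auto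
      also have "\<dots> = (0\<^sub>m n n, 0\<^sub>m n n)"
        using \<Phi>_carrier[of "0\<^sub>v (2 * d)"] by (auto simp: pair_lincomb_def intro!: eq_matI)
      finally show "\<Phi> (R (0\<^sub>m n n)) = \<Phi> (0\<^sub>v (2 * d))"
        unfolding R(2)[OF z] by (auto simp: pair_lincomb_def intro!: eq_matI)
    qed simp
    have "R (Z + Z') = R Z + R Z'" if "Z \<in> carrier ?S" "Z' \<in> carrier ?S" for Z Z'
      using R_lin[OF that, of 1] by simp
    moreover have "R (complex_of_real c \<cdot>\<^sub>m Z) = c \<cdot>\<^sub>v R Z" if Z: "Z \<in> carrier ?S" for c Z
    proof -
      have "R (complex_of_real c \<cdot>\<^sub>m Z + 0\<^sub>m n n) = c \<cdot>\<^sub>v R Z + R (0\<^sub>m n n)"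
        using R_lin[OF Z, of "0\<^sub>m n n" c] S.M.zero_closed by (simp add: S_simps)
      then show ?thesis using R(1)[OF Z] Z by (simp add: zero sol)
    qed
    ultimately show ?thesis using R_ker
      by (auto simp: module_hom_def module_vec_simps S_simps)
  qed
  interpret R: linear_map "class_ring :: real ring" ?S ?K R
    by (unfold_locales) (rule R_hom)
  have R_inj: "inj_on R (carrier ?S)"
  proof (rule inj_onI)
    fix Z Z' assume Z: "Z \<in> carrier ?S" "Z' \<in> carrier ?S" and e: "R Z = R Z'"
    have "(- \<i>) \<cdot>\<^sub>m Z = (- \<i>) \<cdot>\<^sub>m Z'"
      using arg_cong[OF e, of \<Phi>] Z by (simp add: R sol pair_lincomb_def)
    moreover have "\<i> \<cdot>\<^sub>m ((- \<i>) \<cdot>\<^sub>m M) = M" for M by (rule eq_matI) auto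
    ultimately show "Z = Z'" by metis
  qed
  have R_surj: "R ` carrier ?S = carrier ?K"
  proof
    show "R ` carrier ?S \<subseteq> carrier ?K" using R_ker by auto
    show "carrier ?K \<subseteq> R ` carrier ?S"
    proof
      fix v assume "v \<in> carrier ?K"
      then have v: "v \<in> carrier_vec (2 * d)" and a: "fst (\<Phi> v) = mat_adjoint (snd (\<Phi> v))"
        by (auto simp: ker)
      obtain X where X: "\<Phi> v = (mat_adjoint X, X)" using a by (cases "\<Phi> v") auto
      then have c: "X \<in> carrier_mat n n" using \<Phi>_carrier(2)[of v] by simp
      have "pair_lincomb \<i> (\<Phi> v) (0\<^sub>m n n, 0\<^sub>m n n) = (- mat_adjoint (\<i> \<cdot>\<^sub>m X), \<i> \<cdot>\<^sub>m X)"
        using c by (auto simp: X pair_lincomb_def intro!: eq_matI)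
      then have m: "\<i> \<cdot>\<^sub>m X \<in> carrier ?S"
        using H_lin[OF \<Phi>_mem[of v] zero_mem, of \<i>] c by (simp add: sol)
      have "R (\<i> \<cdot>\<^sub>m X) = v"
      proof (rule \<Phi>_inj)
        show "\<Phi> (R (\<i> \<cdot>\<^sub>m X)) = \<Phi> v"
          unfolding R(2)[OF m] X using c by (auto simp: pair_lincomb_def intro!: eq_matI)
      qed (use R(1)[OF m] v in auto)
      then show "v \<in> R ` carrier ?S" using m by blast
    qed
  qed
  have "S.dim = K.dim" by (rule R.dim_eq[OF fdS R_inj R_surj])
  moreover have "S.dim + K.dim = 2 * d"
    using T.rank_nullity[OF fdV] T.surj_imp_imT_carrier[OF surj] by (simp add: dV)
  ultimately show "S.dim = d" by simp
qed

section \<open>Summation over ordered pairs of blocks\<close>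

lemma hom_sum_add_left: "hom_sum (M + M') N = hom_sum M N + hom_sum M' N"
  by (simp add: hom_sum_def)

lemma hom_sum_add_right: "hom_sum M (N + N') = hom_sum M N + hom_sum M N'"
  by (simp add: hom_sum_def sum_mset.distrib)

lemma hom_sum_sum_left: "hom_sum (\<Sum>j\<in>A. F j) N = (\<Sum>j\<in>A. hom_sum (F j) N)"
proof (induction A rule: infinite_finite_induct)
  case (insert x A) then show ?case by (simp add: hom_sum_add_left)
qed (simp_all add: hom_sum_def)

lemma hom_sum_sum_right: "hom_sum M (\<Sum>j\<in>A. F j) = (\<Sum>j\<in>A. hom_sum M (F j))"
proof (induction A rule: infinite_finite_induct)
  case (insert x A) then show ?case by (simp add: hom_sum_add_right)
qed (simp_all add: hom_sum_def)

lemma finite_index_pairs [simp]: "finite (index_pairs k)"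
  by (rule finite_subset[of _ "{1..k} \<times> {1..k}"]) (auto simp: index_pairs_def)

text \<open>A sum over all ordered pairs is rearranged into diagonal terms and terms over \<open>j < k\<close>, the form in which
  the dimension formula is stated.\<close>

lemma sum_index_pairs:
  fixes f :: "nat \<Rightarrow> nat \<Rightarrow> nat"
  shows "(\<Sum>i=1..k. \<Sum>j=1..k. f i j) = (\<Sum>i=1..k. f i i) + (\<Sum>(i, j)\<in>index_pairs k. f i j + f j i)"
proof (induction k)
  case 0
  have "index_pairs 0 = {}" by (auto simp: index_pairs_def)
  then show ?case by simp
next
  case (Suc k)
  have "index_pairs (Suc k) = index_pairs k \<union> (\<lambda>i. (i, Suc k)) ` {1..k}"
    by (auto simp: index_pairs_def image_iff le_Suc_eq)
  moreover have "index_pairs k \<inter> (\<lambda>i. (i, Suc k)) ` {1..k} = {}"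
    by (auto simp: index_pairs_def)
  ultimately have "(\<Sum>(i, j)\<in>index_pairs (Suc k). f i j + f j i) =
      (\<Sum>(i, j)\<in>index_pairs k. f i j + f j i) + (\<Sum>i=1..k. f i (Suc k) + f (Suc k) i)"
    by (simp add: sum.union_disjoint sum.reindex inj_on_def)
  then show ?case using Suc.IH by (simp add: sum.distrib)
qed

lemma hom_sum_single [simp]: "hom_sum {#b#} {#b'#} = block_hom_dim b b'"
  by (simp add: hom_sum_def)

lemma hom_sum_sums_eq_0:
  assumes "\<And>i j. i \<in> A \<Longrightarrow> j \<in> B \<Longrightarrow> hom_sum (F i) (G j) = 0"
  shows "hom_sum (\<Sum>i\<in>A. F i) (\<Sum>j\<in>B. G j) = 0"
  using assms by (simp add: hom_sum_sum_left hom_sum_sum_right)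

text \<open>For a regular block of size \<open>k\<close>, exactly one of the two halves of \<open>L\<^sub>s \<oplus> L\<^sub>s\<^sup>T\<close> admits morphisms to it, and exactly
  the other one from it; both spaces have dimension \<open>k\<close>.\<close>

lemma hom_sum_paired_L_regular:
  assumes "\<And>b. b \<in># N \<Longrightarrow> (\<exists>r z. b = JordanFin r z) \<or> (\<exists>r. b = JordanInf r)"
  shows "hom_sum (paired_L s) N = (\<Sum>b\<in>#N. block_rows b)"
    and "hom_sum N (paired_L s) = (\<Sum>b\<in>#N. block_rows b)"
proof -
  have "(\<Sum>b\<in>#N. block_hom_dim (SingL s) b) = 0" "(\<Sum>b\<in>#N. block_hom_dim (SingLT s) b) = (\<Sum>b\<in>#N. block_rows b)"
    using assms by (induction N) fastforce+
  then show "hom_sum (paired_L s) N = (\<Sum>b\<in>#N. block_rows b)" by (simp add: hom_sum_def paired_L_def)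
  show "hom_sum N (paired_L s) = (\<Sum>b\<in>#N. block_rows b)"
    using assms unfolding hom_sum_def paired_L_def by (induction N) fastforce+
qed

lemma hom_sum_paired_L: "hom_sum (paired_L r) (paired_L s) = (r + 1 - s) + (s + 1 - r) + (r + s)"
  by (simp add: hom_sum_def paired_L_def)

lemma hom_sum_paired_Z: "hom_sum (paired_Z r) (paired_Z s) = 2 * min r s"
  by (simp add: hom_sum_def paired_Z_def)

lemma eigenvalue_sim_iff:
  assumes "w \<noteq> 0"
  shows "eigenvalue_sim z w \<longleftrightarrow> z = w \<or> z = 1 / cnj w"
  using assms by (auto simp: eigenvalue_sim_def doubleton_eq_iff)

lemma norm_inverse_cnj: "cmod (1 / cnj z) = 1 / cmod z"
  by (simp add: norm_divide)

text \<open>Since \<open>|z| \<noteq> 1\<close>, the two eigenvalues of a pair are distinct. Hence an eigenvalue of the first pair meets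
  at most one of the second, and if one of them does, then so does the other: this is the factor \<open>2\<close>.\<close>

lemma hom_sum_paired_J:
  assumes "cmod z \<noteq> 0" "cmod z \<noteq> 1" "cmod w \<noteq> 0" "cmod w \<noteq> 1"
  shows "hom_sum (paired_J r z) (paired_J s w) = (if eigenvalue_sim z w then 2 * min r s else 0)"
proof -
  have ne: "z \<noteq> 0" "w \<noteq> 0" using assms by auto
  have a: "1 / cnj z = w \<longleftrightarrow> z = 1 / cnj w"
  proof
    assume "1 / cnj z = w"
    then have "w = 1 / cnj z" by simp
    then show "z = 1 / cnj w" by simp
  qed simp
  have b: "1 / cnj z = 1 / cnj w \<longleftrightarrow> z = w" using ne by auto
  have c: "z \<noteq> 1 / cnj w" if "z = w"
  proof
    assume "z = 1 / cnj w"
    then have "cmod w = 1 / cmod w" using that by (metis norm_inverse_cnj)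
    then have "cmod w * cmod w = 1" using assms by (simp add: field_simps)
    then show False using assms(4) by (metis norm_ge_zero abs_of_nonneg abs_1 power2_eq_square real_sqrt_abs real_sqrt_one)
  qed
  show ?thesis
    using c by (auto simp: hom_sum_def paired_J_def a b eigenvalue_sim_iff[OF ne(2)])
qed

theorem theorem4p3:
  fixes n a b c d :: nat
    and J :: "complex mat"
    and s t m p :: "nat \<Rightarrow> nat"
    and \<alpha> lam :: "nat \<Rightarrow> complex"
  assumes "J \<in> carrier_mat n n"
    and "has_kronecker_structure (J, mat_adjoint J)
           ((\<Sum>j=1..a. paired_L (s j)) + (\<Sum>j=1..b. paired_Z (t j))
            + (\<Sum>j=1..c. {#JordanFin (m j) (\<alpha> j)#}) + (\<Sum>j=1..d. paired_J (p j) (lam j)))"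
    and "\<forall>j\<in>{1..c}. cmod (\<alpha> j) = 1"
    and "\<forall>j\<in>{1..d}. cmod (lam j) \<noteq> 0 \<and> cmod (lam j) \<noteq> 1"
    and "D_L = (\<Sum>j=1..a. 2 * s j + 2)
                + (\<Sum>(j, k)\<in>index_pairs a. 2 * max (2 * s j + 1) (2 * s k + 1))
                + 2 * card {(j, k)\<in>index_pairs a. s j = s k}"
    and "D_Z = (\<Sum>j=1..b. 2 * t j) + (\<Sum>(j, k)\<in>index_pairs b. min (4 * t j) (4 * t k))"
    and "D_\<alpha> = (\<Sum>j=1..c. m j)
                + (\<Sum>(j, k)\<in>{(j, k)\<in>index_pairs c. \<alpha> j = \<alpha> k}. min (2 * m j) (2 * m k))"
    and "D_P = (\<Sum>j=1..d. 2 * p j)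
                + (\<Sum>(j, k)\<in>{(j, k)\<in>index_pairs d. eigenvalue_sim (lam j) (lam k)}.
                     min (4 * p j) (4 * p k))"
    and "D_I = (\<Sum>j=1..a. 2 * int n - (\<Sum>k=1..a. 4 * int (s k) + 2))"
  shows "vectorspace.fin_dim class_ring (solution_space n J)
    \<and> D_I = int a * (2 * int n - (\<Sum>k=1..a. 4 * int (s k) + 2))
    \<and> int (vectorspace.dim class_ring (solution_space n J))
        = int D_L + int D_Z + int D_\<alpha> + int D_P + D_I"
proof (intro conjI)
  let ?L = "\<Sum>j=1..a. paired_L (s j)" and ?Z = "\<Sum>j=1..b. paired_Z (t j)"
    and ?A = "\<Sum>j=1..c. {#JordanFin (m j) (\<alpha> j)#}" and ?P = "\<Sum>j=1..d. paired_J (p j) (lam j)"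
  let ?R = "?Z + ?A + ?P" and ?M = "?L + ?Z + ?A + ?P"
  have H: "mat_adjoint J \<in> carrier_mat n n" by (rule mat_adjoint_carrier[OF assms(1)])
  note K = kronecker_structure_hom_dim[OF assms(2,1) H]
  show "vectorspace.fin_dim class_ring (solution_space n J)"
    by (rule solution_space_dim[OF assms(1) K(1)])
  have dim: "vectorspace.dim class_ring (solution_space n J) = hom_sum ?M ?M"
    by (rule solution_space_dim[OF assms(1) K(1)])
  show D_I: "D_I = int a * (2 * int n - (\<Sum>k=1..a. 4 * int (s k) + 2))"
    using assms(9) by simp
  \<comment> \<open>Regular blocks of different kinds have no eigenvalue in common.\<close>
  have ZA: "hom_sum ?Z ?A = 0" "hom_sum ?A ?Z = 0"
    using assms(3) by (intro hom_sum_sums_eq_0; force simp: hom_sum_def paired_Z_def)+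
  have ZP: "hom_sum ?Z ?P = 0" "hom_sum ?P ?Z = 0"
    using assms(4) by (intro hom_sum_sums_eq_0; force simp: hom_sum_def paired_Z_def paired_J_def)+
  have AP: "hom_sum ?A ?P = 0" "hom_sum ?P ?A = 0"
  proof -
    have "\<alpha> j \<noteq> lam k \<and> \<alpha> j \<noteq> 1 / cnj (lam k)" if "j \<in> {1..c}" "k \<in> {1..d}" for j k
    proof -
      have "cmod (\<alpha> j) = 1" "cmod (lam k) \<noteq> 0" "cmod (lam k) \<noteq> 1" using assms(3,4) that by auto
      moreover from this have "cmod (1 / cnj (lam k)) \<noteq> 1" by (simp add: norm_inverse_cnj)
      ultimately show ?thesis by metis
    qed
    then have "hom_sum {#JordanFin (m j) (\<alpha> j)#} (paired_J (p k) (lam k)) = 0"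
      "hom_sum (paired_J (p k) (lam k)) {#JordanFin (m j) (\<alpha> j)#} = 0"
      if "j \<in> {1..c}" "k \<in> {1..d}" for j k
      using that by (fastforce simp: hom_sum_def paired_J_def)+
    then show "hom_sum ?A ?P = 0" "hom_sum ?P ?A = 0"
      by (intro hom_sum_sums_eq_0; simp)+
  qed
  have filter: "(\<Sum>(j, k)\<in>{(j, k)\<in>index_pairs l. Q j k}. f j k) = (\<Sum>(j, k)\<in>index_pairs l. if Q j k then f j k else 0)"
    for l Q and f :: "nat \<Rightarrow> nat \<Rightarrow> nat"
    by (rule sum.mono_neutral_cong_left) (auto split: if_splits)
  \<comment> \<open>For \<open>i < j\<close> the truncated differences add up to \<open>\<bar>s i - s j\<bar> + 1\<close>, and to one more if \<open>s i = s j\<close>; this excess is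
    the origin of the cardinality in \<open>D_L\<close>.\<close>
  have LL: "hom_sum ?L ?L = D_L"
  proof -
    have "hom_sum ?L ?L = (\<Sum>i=1..a. \<Sum>j=1..a. (s i + 1 - s j) + (s j + 1 - s i) + (s i + s j))"
      unfolding hom_sum_sum_left unfolding hom_sum_sum_right by (simp add: hom_sum_paired_L)
    also have "\<dots> = (\<Sum>j=1..a. 2 * s j + 2) + (\<Sum>(i, j)\<in>index_pairs a.
        2 * max (2 * s i + 1) (2 * s j + 1) + (if s i = s j then 2 else 0))"
      unfolding sum_index_pairs by (rule arg_cong2[where f = "(+)"]; rule sum.cong) auto
    also have "\<dots> = (\<Sum>j=1..a. 2 * s j + 2) + (\<Sum>(i, j)\<in>index_pairs a. 2 * max (2 * s i + 1) (2 * s j + 1))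
        + 2 * card {(j, k)\<in>index_pairs a. s j = s k}"
    proof -
      have "(\<Sum>(i, j)\<in>index_pairs a. if s i = s j then 2 else 0) = 2 * card {(j, k)\<in>index_pairs a. s j = s k}"
        unfolding filter[symmetric] by simp
      then show ?thesis by (simp only: case_prod_unfold sum.distrib add.assoc)
    qed
    finally show ?thesis using assms(5) by simp
  qed
  have ZZ: "hom_sum ?Z ?Z = D_Z"
  proof -
    have "hom_sum ?Z ?Z = (\<Sum>i=1..b. \<Sum>j=1..b. 2 * min (t i) (t j))"
      unfolding hom_sum_sum_left unfolding hom_sum_sum_right by (simp add: hom_sum_paired_Z)
    also have "\<dots> = D_Z"
      unfolding sum_index_pairs assms(6) by (rule arg_cong2[where f = "(+)"]; rule sum.cong) auto
    finally show ?thesis .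
  qed
  have AA: "hom_sum ?A ?A = D_\<alpha>"
  proof -
    have "hom_sum ?A ?A = (\<Sum>i=1..c. \<Sum>j=1..c. if \<alpha> i = \<alpha> j then min (m i) (m j) else 0)"
      unfolding hom_sum_sum_left unfolding hom_sum_sum_right by simp
    also have "\<dots> = D_\<alpha>"
      unfolding sum_index_pairs assms(7) filter by (rule arg_cong2[where f = "(+)"]; rule sum.cong) auto
    finally show ?thesis .
  qed
  have PP: "hom_sum ?P ?P = D_P"
  proof -
    have sym: "eigenvalue_sim z w \<longleftrightarrow> eigenvalue_sim w z" "eigenvalue_sim z z" for z w
      by (auto simp: eigenvalue_sim_def)
    have "hom_sum ?P ?P = (\<Sum>i=1..d. \<Sum>j=1..d. if eigenvalue_sim (lam i) (lam j) then 2 * min (p i) (p j) else 0)"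
      unfolding hom_sum_sum_left unfolding hom_sum_sum_right
      using assms(4) by (intro sum.cong refl hom_sum_paired_J) auto
    also have "\<dots> = D_P"
      unfolding sum_index_pairs assms(8) filter
      by (rule arg_cong2[where f = "(+)"]; rule sum.cong) (auto simp: sym(2) dest: sym(1)[THEN iffD1])
    finally show ?thesis .
  qed
  \<comment> \<open>The size of the regular part.\<close>
  define N where "N = (\<Sum>b\<in>#?R. block_rows b)"
  have reg: "(\<exists>r z. b = JordanFin r z) \<or> (\<exists>r. b = JordanInf r)" if "b \<in># ?R" for b
    using that by (auto simp: set_mset_sum paired_Z_def paired_J_def)
  have LR: "hom_sum ?L ?R = a * N" "hom_sum ?R ?L = a * N"
  proof -
    have L: "hom_sum (paired_L r) ?R = N" "hom_sum ?R (paired_L r) = N" for r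
      unfolding N_def by (rule hom_sum_paired_L_regular; rule reg; assumption)+
    show "hom_sum ?L ?R = a * N" unfolding hom_sum_sum_left[of _ _ ?R] L by simp
    show "hom_sum ?R ?L = a * N" unfolding hom_sum_sum_right[of ?R] L by simp
  qed
  have n: "n = (\<Sum>j=1..a. 2 * s j + 1) + N"
  proof -
    have "(\<Sum>b\<in>#?L. block_rows b) = (\<Sum>j=1..a. 2 * s j + 1)"
      by (induction a) (simp_all add: paired_L_def)
    then show ?thesis using K(2) by (simp add: N_def add.assoc)
  qed
  have total: "hom_sum ?M ?M = D_L + D_Z + D_\<alpha> + D_P + 2 * a * N"
    using LR LL ZZ AA PP ZA ZP AP by (simp add: hom_sum_add_left hom_sum_add_right)
  have "2 * int n - (\<Sum>k=1..a. 4 * int (s k) + 2) = 2 * int N"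
    unfolding n by (simp add: sum_distrib_left algebra_simps flip: sum.distrib)
  then have "D_I = int (2 * a * N)" unfolding D_I by simp
  then show "int (vectorspace.dim class_ring (solution_space n J))
        = int D_L + int D_Z + int D_\<alpha> + int D_P + D_I"
    unfolding dim total by simp
qed

end
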